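(* Let $\mathbf{x}=(x_1,\dots,x_n)$ be an ordered $n$-tuple in $[0,1)$, i.e. $0\le x_1<x_2<\dots<x_n<1$, and let $\boldsymbol{\alpha}=(\alpha_1,\dots,\alpha_n)\in\{0,1,\dots,d^2-1\}^{n}$. Let $P\in\mathcal{D}$ be the minimal supporting partition of $\mathbf{x}$. Then the limit (of the net indexed by the partitions $Q\in\mathcal{D}$ with $P\preceq Q$, directed by refinement) $$C^{\alpha_1\alpha_2\cdots\alpha_n}(x_1,x_2,\dots,x_n)=\lim_{P\preceq Q}\langle\Omega_Q|M^{\boldsymbol{\alpha}}_Q(\mathbf{x})|\Omega_Q\rangle$$ exists and is equal to $$\langle\Omega_P|M^{\boldsymbol{\alpha}}_P(\mathbf{x})|\Omega_P\rangle .$$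
   Context: Isometry and ascending operators: $d$ is a positive integer and $V\colon\mathbb{C}^d\to\mathbb{C}^d\otimes\mathbb{C}^d$ is an isometry that is unchanged when followed by the swap of the two tensor factors of $\mathbb{C}^d\otimes\mathbb{C}^d$. Define $\mathcal{E}\colon M_d(\mathbb{C})\to M_d(\mathbb{C})$ by $\mathcal{E}(X)=V^\dagger(X\otimes\mathbb{I})V$. It is assumed that $\mathcal{E}$ is diagonalisable with a basis of eigenvectors $\mu^\alpha\in M_d(\mathbb{C})$, $\mathcal{E}(\mu^\alpha)=\lambda_\alpha\mu^\alpha$, $\alpha=0,1,\dots,d^2-1$, with $\mu^0=\mathbb{I}$, $\lambda_0=1$, and that $\lambda_\alpha\neq0$ for all $\alpha$. Partitions: a standard dyadic interval is $[\frac{a}{2^m},\frac{a+1}{2^m})$ with integers $m\ge0$, $0\le a\le 2^m-1$. $\mathcal{D}$ is the directed set of standard dyadic partitions of $[0,1)$, i.e. finite partitions of $[0,1)$ into standard dyadic intervals; $P\preceq Q$ means that $Q$ refines $P$. A partition $P\in\mathcal{D}$ is supporting for $\mathbf{x}$ if each interval of $P$ contains at most one entry of $\mathbf{x}$; it is a minimal supporting partition if there is no coarser supporting partition (the minimal supporting partition is unique). Hilbert spaces and vacuum: for $P\in\mathcal{D}$, $\mathcal{H}_P=\bigotimes_{I\in P}\mathbb{C}^d$. For $P\preceq Q$, the isometry $T^P_Q\colon\mathcal{H}_P\to\mathcal{H}_Q$ is obtained by applying $V$ for each halving of an interval needed to pass from $P$ to $Q$ (the factor of an interval is mapped by $V$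 to the tensor product of the factors of its left and right halves). $\mathcal{H}$ is the Hilbert space completion of the direct limit of $(\mathcal{H}_P,T^P_Q)$, and $[\psi]$ denotes the class of $\psi\in\mathcal{H}_P$. The vacuum vector is $|\Omega\rangle=[|\Omega_2\rangle]$, where $|\Omega_2\rangle=\frac{1}{\sqrt d}\sum_{j=0}^{d-1}|jj\rangle$ lives on the partition $\{[0,\frac12),[\frac12,1)\}$, and $|\Omega_Q\rangle\in\mathcal{H}_Q$ denotes the representative of the vacuum on $Q$, i.e. $[|\Omega_Q\rangle]=|\Omega\rangle$ (thus $|\Omega_Q\rangle$ is the image of $|\Omega_2\rangle$ under the corresponding isometry when $Q$ refines $\{[0,\frac12),[\frac12,1)\}$). Field operators: for $Q\in\mathcal{D}$ and $z\in[0,1)$, the discretised field operator of type $\alpha$ is $\phi^\alpha_Q(z)=\sum_{I\in Q}\chi_I(z)\,(\lambda_\alpha)^{\log_2(|I|)}\mu^\alpha_I\in\mathcal{B}(\mathcal{H}_Q)$, where $\chi_I$ is the indicator function of $I$, $|I|$ is the length of $I$, and $\mu^\alpha_I$ acts as $\mu^\alpha$ on the factor of $I$ and as the identity on the others. Finally $M^{\boldsymbol{\alpha}}_Q(\mathbf{x})=\prod_{j=1}^n\phi_Q^{\alpha_j}(x_j)$; for $Q$ supporting $\mathbf{x}$ the factors commute.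
   Formalization: For n ≤ 1 the minimal supporting partition is {[0,1)}, where the vacuum representative need not exist; the limit is shown to exist for every n, and its equality with the value at P for n ≥ 2, or whenever the vacuum has a representative on P. *)

theory Defs
  imports "HOL-Analysis.Analysis" "HOL-Library.Disjoint_Sets"
begin

section \<open>Matrices, the isometry and the ascending channel\<close>

text \<open>
  \<open>\<complex>\<^sup>d\<close> is \<^typ>\<open>complex^'d\<close>, so \<open>d\<close> is \<open>CARD('d)\<close>, and the tensor square of \<open>\<complex>\<^sup>d\<close> is
  \<^typ>\<open>complex^('d::finite \<times> 'd)\<close>, the basis vector \<open>|j\<rangle> \<otimes> |k\<rangle>\<close> having index \<open>(j, k)\<close>.
\<close>

definition cmat_scale :: "complex \<Rightarrow> complex^'n^'m \<Rightarrow> complex^'n^'m" where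
  "cmat_scale c A = (\<chi> i j. c * A $ i $ j)"

global_interpretation cmat: vector_space "cmat_scale :: complex \<Rightarrow> complex^'n^'m \<Rightarrow> complex^'n^'m"
  by unfold_locales (simp_all add: cmat_scale_def vec_eq_iff algebra_simps)

definition cadjoint :: "complex^'n^'m \<Rightarrow> complex^'m^'n" where
  "cadjoint A = (\<chi> i j. cnj (A $ j $ i))"

definition kronecker :: "complex^'n^'m \<Rightarrow> complex^'l^'k \<Rightarrow> complex^('n::finite \<times> 'l::finite)^('m::finite \<times> 'k::finite)" where
  "kronecker A B = (\<chi> p q. A $ fst p $ fst q * B $ snd p $ snd q)"

definition isometry :: "complex^'n^'m \<Rightarrow> bool" where
  "isometry V \<longleftrightarrow> cadjoint V ** V = mat 1"

definition swap_factors :: "complex^('n::finite \<times> 'n) \<Rightarrow> complex^('n \<times> 'n)" where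
  "swap_factors w = (\<chi> p. w $ prod.swap p)"

definition ascend :: "complex^'d^('d::finite \<times> 'd) \<Rightarrow> complex^'d^'d \<Rightarrow> complex^'d^'d" where
  "ascend V X = cadjoint V ** kronecker X (mat 1) ** V"


section \<open>Standard dyadic partitions\<close>

definition std_dyadic_interval :: "real set \<Rightarrow> bool" where
  "std_dyadic_interval I \<longleftrightarrow>
     (\<exists>m a :: nat. a < 2 ^ m \<and> I = {real a / 2 ^ m ..< (real a + 1) / 2 ^ m})"

definition dyadic_partitions :: "real set set set" where
  "dyadic_partitions =
     {P. finite P \<and> partition_on {0..<1} P \<and> (\<forall>I\<in>P. std_dyadic_interval I)}"

text \<open>\<open>P \<preceq> Q\<close>: the partition \<open>Q\<close> refines \<open>P\<close>; note that \<^const>\<open>refines\<close> takes the finer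
  partition first.\<close>

definition coarser :: "real set set \<Rightarrow> real set set \<Rightarrow> bool" (infix "\<preceq>" 50) where
  "P \<preceq> Q \<longleftrightarrow> P \<in> dyadic_partitions \<and> Q \<in> dyadic_partitions \<and> refines {0..<1} Q P"

definition supporting :: "real list \<Rightarrow> real set set \<Rightarrow> bool" where
  "supporting xs P \<longleftrightarrow>
     P \<in> dyadic_partitions \<and>
     (\<forall>I\<in>P. \<forall>i<length xs. \<forall>j<length xs. xs ! i \<in> I \<and> xs ! j \<in> I \<longrightarrow> i = j)"

definition minimal_supporting :: "real list \<Rightarrow> real set set \<Rightarrow> bool" where
  "minimal_supporting xs P \<longleftrightarrow>
     supporting xs P \<and> \<not> (\<exists>P'. supporting xs P' \<and> P' \<preceq> P \<and> P' \<noteq> P)"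

text \<open>The filter of tails of the directed set of all \<open>Q\<close> with \<open>P \<preceq> Q\<close>; convergence along it is
  convergence of the net indexed by these \<open>Q\<close>.\<close>

definition refinement_filter :: "real set set \<Rightarrow> real set set filter" where
  "refinement_filter P = (INF R\<in>{R. P \<preceq> R}. principal {Q. R \<preceq> Q})"


section \<open>The Hilbert spaces of partitions and their direct limit\<close>

text \<open>
  A vector of the tensor power of \<open>\<complex>\<^sup>d\<close> over a finite set \<open>P\<close> of intervals is given by its
  coefficients in the product basis, which is indexed by the functions from \<open>P\<close> to \<^typ>\<open>'d\<close>
  (\<^const>\<open>undefined\<close> off \<open>P\<close>); coefficients at all other functions are zero.
\<close>

type_synonym 'd config = "real set \<Rightarrow> 'd"
type_synonym 'd state = "'d config \<Rightarrow> complex"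

definition configs :: "real set set \<Rightarrow> 'd config set" where
  "configs P = P \<rightarrow>\<^sub>E UNIV"

definition hilbert :: "real set set \<Rightarrow> 'd state set" where
  "hilbert P = {\<psi>. \<forall>s. s \<notin> configs P \<longrightarrow> \<psi> s = 0}"

definition ket :: "'d config \<Rightarrow> 'd state" where
  "ket t = (\<lambda>s. if s = t then 1 else 0)"

definition cinner :: "real set set \<Rightarrow> 'd state \<Rightarrow> 'd state \<Rightarrow> complex" where
  "cinner P \<phi> \<psi> = (\<Sum>s\<in>configs P. cnj (\<phi> s) * \<psi> s)"

definition left_half :: "real set \<Rightarrow> real set" where
  "left_half I = {Inf I ..< (Inf I + Sup I) / 2}"

definition right_half :: "real set \<Rightarrow> real set" where
  "right_half I = {(Inf I + Sup I) / 2 ..< Sup I}"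

definition halve :: "real set set \<Rightarrow> real set \<Rightarrow> real set set" where
  "halve P I = insert (left_half I) (insert (right_half I) (P - {I}))"

text \<open>\<open>V\<close> on the factor of \<open>I\<close> (with values in the factors of its left and right halves, in this
  order) and the identity on the other factors of \<open>P\<close>.\<close>

definition apply_halving ::
    "complex^'d^('d::finite \<times> 'd) \<Rightarrow> real set set \<Rightarrow> real set \<Rightarrow> 'd state \<Rightarrow> 'd state" where
  "apply_halving V P I \<psi> = (\<lambda>s.
     if s \<in> configs (halve P I)
     then \<Sum>i\<in>UNIV. V $ (s (left_half I), s (right_half I)) $ i * \<psi> ((restrict s (P - {I}))(I := i))
     else 0)"

inductive halvings ::
    "complex^'d^('d::finite \<times> 'd) \<Rightarrow> real set set \<Rightarrow> real set set \<Rightarrow> ('d state \<Rightarrow> 'd state) \<Rightarrow> bool"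
  for V and P where
  refl: "halvings V P P id"
| step: "halvings V P Q T \<Longrightarrow> I \<in> Q \<Longrightarrow> halvings V P (halve Q I) (apply_halving V Q I \<circ> T)"

definition transition ::
    "complex^'d^('d::finite \<times> 'd) \<Rightarrow> real set set \<Rightarrow> real set set \<Rightarrow> 'd state \<Rightarrow> 'd state" where
  "transition V P Q = (THE T. halvings V P Q T)"

text \<open>
  The class of \<open>\<psi>\<close> in the direct limit. The direct limit embeds in its completion, and the vacuum
  lies in the direct limit, so equality of classes here is equality in the completion.
\<close>

definition limit_class ::
    "complex^'d^('d::finite \<times> 'd) \<Rightarrow> real set set \<Rightarrow> 'd state \<Rightarrow> (real set set \<times> 'd state) set" where
  "limit_class V P \<psi> = {(Q, \<phi>). Q \<in> dyadic_partitions \<and> \<phi> \<in> hilbert Q \<and>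
     (\<exists>R. P \<preceq> R \<and> Q \<preceq> R \<and> transition V P R \<psi> = transition V Q R \<phi>)}"


section \<open>The vacuum\<close>

definition halves :: "real set set" where
  "halves = {{0..<1/2}, {1/2..<1}}"

definition vacuum_2 :: "('d::finite) state" where
  "vacuum_2 = (\<lambda>s. 1 / complex_of_real (sqrt (CARD('d))) * (\<Sum>j\<in>UNIV. ket (restrict (\<lambda>_. j) halves) s))"

definition vacuum :: "complex^'d^('d::finite \<times> 'd) \<Rightarrow> (real set set \<times> 'd state) set" where
  "vacuum V = limit_class V halves vacuum_2"

text \<open>
  Since the vacuum is given on \<^const>\<open>halves\<close>, it is represented on every refinement of
  \<^const>\<open>halves\<close>, but on the trivial partition only if \<^const>\<open>vacuum_2\<close> is in the range of \<open>V\<close>.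
\<close>

definition has_vacuum_rep :: "complex^'d^('d::finite \<times> 'd) \<Rightarrow> real set set \<Rightarrow> bool" where
  "has_vacuum_rep V Q \<longleftrightarrow> (\<exists>\<psi>\<in>hilbert Q. limit_class V Q \<psi> = vacuum V)"

definition vacuum_rep :: "complex^'d^('d::finite \<times> 'd) \<Rightarrow> real set set \<Rightarrow> 'd state" where
  "vacuum_rep V Q = (THE \<psi>. \<psi> \<in> hilbert Q \<and> limit_class V Q \<psi> = vacuum V)"


section \<open>Discretised field operators\<close>

definition local_op :: "real set set \<Rightarrow> complex^'d^'d \<Rightarrow> real set \<Rightarrow> 'd state \<Rightarrow> 'd state" where
  "local_op Q A I \<psi> = (\<lambda>s.
     if s \<in> configs Q then \<Sum>k\<in>UNIV. A $ s I $ k * \<psi> (s(I := k)) else 0)"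

text \<open>The logarithm below is an integer (at most 0) for a standard dyadic interval, so taking
  the floor only changes its type.\<close>

definition field_op ::
    "(nat \<Rightarrow> complex) \<Rightarrow> (nat \<Rightarrow> complex^'d^'d) \<Rightarrow> nat \<Rightarrow> real set set \<Rightarrow> real \<Rightarrow>
     'd state \<Rightarrow> 'd state" where
  "field_op lam \<mu> \<alpha> Q z \<psi> = (\<lambda>s.
     \<Sum>I\<in>Q. indicator I z * lam \<alpha> powi \<lfloor>log 2 (measure lborel I)\<rfloor> * local_op Q (\<mu> \<alpha>) I \<psi> s)"

definition field_product ::
    "(nat \<Rightarrow> complex) \<Rightarrow> (nat \<Rightarrow> complex^'d^'d) \<Rightarrow> nat list \<Rightarrow> real list \<Rightarrow> real set set \<Rightarrow>
     'd state \<Rightarrow> 'd state" where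
  "field_product lam \<mu> \<alpha>s xs Q =
     foldr (\<circ>) (map (\<lambda>(\<alpha>, x). field_op lam \<mu> \<alpha> Q x) (zip \<alpha>s xs)) id"

definition vacuum_expectation ::
    "complex^'d^('d::finite \<times> 'd) \<Rightarrow> (nat \<Rightarrow> complex) \<Rightarrow> (nat \<Rightarrow> complex^'d^'d) \<Rightarrow>
     nat list \<Rightarrow> real list \<Rightarrow> real set set \<Rightarrow> complex" where
  "vacuum_expectation V lam \<mu> \<alpha>s xs Q =
     cinner Q (vacuum_rep V Q) (field_product lam \<mu> \<alpha>s xs Q (vacuum_rep V Q))"

text \<open>The \<open>n\<close>-point function, where \<open>P\<close> is the minimal supporting partition of \<open>xs\<close>.\<close>

definition correlation ::
    "complex^'d^('d::finite \<times> 'd) \<Rightarrow> (nat \<Rightarrow> complex) \<Rightarrow> (nat \<Rightarrow> complex^'d^'d) \<Rightarrow>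
     nat list \<Rightarrow> real list \<Rightarrow> real set set \<Rightarrow> complex" where
  "correlation V lam \<mu> \<alpha>s xs P = Lim (refinement_filter P) (vacuum_expectation V lam \<mu> \<alpha>s xs)"

end

theory Submission
  imports Defs
begin

text \<open>
  The intertwining relation \<open>V\<^sup>\<dagger> (\<mu>\<^sup>\<alpha> \<otimes> 1) V = V\<^sup>\<dagger> (1 \<otimes> \<mu>\<^sup>\<alpha>) V = \<lambda>\<^sub>\<alpha> \<mu>\<^sup>\<alpha>\<close> (the first equality is the swap
  symmetry of \<open>V\<close>) compensates exactly for the factor \<open>\<lambda>\<^sub>\<alpha>\<close> by which the field operator of type \<open>\<alpha>\<close>
  is divided when the interval of its point is halved. Hence \<open>W\<^sup>\<dagger> M\<^bsub>Q'\<^esub> W = M\<^bsub>Q\<^esub>\<close> when \<open>Q'\<close> arises by one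
  halving, with isometry \<open>W\<close>, from a supporting partition \<open>Q\<close>: at most one of the field operators is
  affected by the halving and the others commute with everything in sight. As the vacuum
  representatives are carried to one another by the transition isometries, the net of vacuum
  expectations is constant beyond any supporting partition on which the vacuum is represented.
\<close>

section \<open>Dyadic partitions\<close>

text \<open>The bound on the index is left out, so cells may lie to the right of
  \<open>[0, 1)\<close>; nesting and halving become arithmetic in the level \<open>m\<close> and the
  index \<open>a\<close>.\<close>

definition dyadic_cell :: "nat \<Rightarrow> nat \<Rightarrow> real set" where
  "dyadic_cell m a = {real a / 2 ^ m ..< (real a + 1) / 2 ^ m}"

lemma std_dyadic_interval_iff:
  "std_dyadic_interval I \<longleftrightarrow> (\<exists>m a. a < 2 ^ m \<and> I = dyadic_cell m a)"
  by (simp add: std_dyadic_interval_def dyadic_cell_def)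

text \<open>Turns membership into a floor equation, so that comparing levels becomes integer
  division.\<close>

lemma mem_dyadic_cell_iff: "x \<in> dyadic_cell m a \<longleftrightarrow> \<lfloor>2 ^ m * x\<rfloor> = int a"
  by (auto simp: dyadic_cell_def floor_eq_iff field_simps)

lemma left_end_mem_dyadic_cell: "real a / 2 ^ m \<in> dyadic_cell m a"
  by (simp add: mem_dyadic_cell_iff)

text \<open>The floor at level \<open>m\<close> is the floor at level \<open>n\<close> divided by
  \<open>2 ^ (n - m)\<close>. The fine index thus determines the coarse one, and a single common
  point fixes it on the whole fine cell.\<close>

lemma dyadic_cell_nested:
  assumes "m \<le> n" and "dyadic_cell m a \<inter> dyadic_cell n b \<noteq> {}"
  shows "dyadic_cell n b \<subseteq> dyadic_cell m a"
proof -
  have coarse: "\<lfloor>2 ^ m * y\<rfloor> = \<lfloor>2 ^ n * y\<rfloor> div 2 ^ (n - m)" for y :: real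
  proof -
    have "2 ^ m * y = 2 ^ n * y / real_of_int (2 ^ (n - m))"
      using assms(1) by (simp add: le_imp_power_dvd real_of_int_div power_diff)
    then show ?thesis
      using floor_divide_real_eq_div[of "2 ^ (n - m)" "2 ^ n * y"] by simp
  qed
  from assms(2) obtain x :: real where "\<lfloor>2 ^ m * x\<rfloor> = int a" "\<lfloor>2 ^ n * x\<rfloor> = int b"
    by (auto simp: mem_dyadic_cell_iff)
  then have "int b div 2 ^ (n - m) = int a"
    using coarse[of x] by simp
  then show ?thesis
    using coarse by (auto simp: mem_dyadic_cell_iff)
qed

lemma Inf_dyadic_cell: "Inf (dyadic_cell m a) = real a / 2 ^ m"
  and Sup_dyadic_cell: "Sup (dyadic_cell m a) = (real a + 1) / 2 ^ m"
  by (simp_all add: dyadic_cell_def divide_strict_right_mono)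

lemma left_half_dyadic_cell: "left_half (dyadic_cell m a) = dyadic_cell (Suc m) (2 * a)"
  and right_half_dyadic_cell: "right_half (dyadic_cell m a) = dyadic_cell (Suc m) (2 * a + 1)"
  by (auto simp: left_half_def right_half_def Inf_dyadic_cell Sup_dyadic_cell)
     (auto simp: dyadic_cell_def field_simps)

lemma std_dyadic_interval_nonempty: "std_dyadic_interval I \<Longrightarrow> I \<noteq> {}"
  using left_end_mem_dyadic_cell by (auto simp: std_dyadic_interval_iff)

lemma std_dyadic_interval_nested:
  assumes "std_dyadic_interval I" "std_dyadic_interval J" "I \<inter> J \<noteq> {}"
  shows "I \<subseteq> J \<or> J \<subseteq> I"
proof -
  obtain m a n b where "I = dyadic_cell m a" "J = dyadic_cell n b"
    using assms(1,2) by (auto simp: std_dyadic_interval_iff)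
  then show ?thesis
    using dyadic_cell_nested[of m n a b] dyadic_cell_nested[of n m b a] assms(3)
    by (cases "m \<le> n") (auto simp: Int_commute)
qed

lemma std_dyadic_interval_halves:
  assumes "std_dyadic_interval I"
  shows "std_dyadic_interval (left_half I)" "std_dyadic_interval (right_half I)"
proof -
  obtain m a where "a < 2 ^ m" "I = dyadic_cell m a"
    using assms by (auto simp: std_dyadic_interval_iff)
  moreover from this have "2 * a < 2 ^ Suc m" "2 * a + 1 < 2 ^ Suc m"
    by simp_all
  ultimately show "std_dyadic_interval (left_half I)" "std_dyadic_interval (right_half I)"
    unfolding std_dyadic_interval_iff using left_half_dyadic_cell right_half_dyadic_cell by blast+
qed

lemma halves_partition:
  assumes "std_dyadic_interval I"
  shows "left_half I \<union> right_half I = I" "left_half I \<inter> right_half I = {}"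
proof -
  obtain m a where I: "I = dyadic_cell m a"
    using assms by (auto simp: std_dyadic_interval_iff)
  have "Inf I \<le> (Inf I + Sup I) / 2" "(Inf I + Sup I) / 2 \<le> Sup I" "I = {Inf I ..< Sup I}"
    unfolding I Inf_dyadic_cell Sup_dyadic_cell by (auto simp: dyadic_cell_def field_simps)
  then show "left_half I \<union> right_half I = I" "left_half I \<inter> right_half I = {}"
    unfolding left_half_def right_half_def by (metis ivl_disj_un_two(3)) auto
qed

text \<open>A proper subcell has a strictly larger level, hence at least the level of the halves,
  and is nested in whichever half it meets.\<close>

lemma psubset_std_dyadic_interval:
  assumes I: "std_dyadic_interval I" and J: "std_dyadic_interval J" and "J \<subset> I"
  shows "J \<subseteq> left_half I \<or> J \<subseteq> right_half I"
proof -
  obtain m a n b where Ieq: "I = dyadic_cell m a" and Jeq: "J = dyadic_cell n b"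
    using I J by (auto simp: std_dyadic_interval_iff)
  have "J \<noteq> {}"
    using J by (rule std_dyadic_interval_nonempty)
  then have meet: "left_half I \<inter> J \<noteq> {} \<or> right_half I \<inter> J \<noteq> {}"
    using halves_partition(1)[OF I] \<open>J \<subset> I\<close> by blast
  \<comment> \<open>Otherwise nesting in the other direction would give
    \<open>I \<subseteq> J\<close>.\<close>
  have "\<not> n \<le> m"
    using dyadic_cell_nested[of n m b a] \<open>J \<subset> I\<close> \<open>J \<noteq> {}\<close> unfolding Ieq Jeq by blast
  then have "Suc m \<le> n"
    by simp
  then show ?thesis
    using meet dyadic_cell_nested
    unfolding Ieq Jeq left_half_dyadic_cell right_half_dyadic_cell by metis
qed

text \<open>A cell of level \<open>m\<close> has length \<open>1 / 2 ^ m\<close>, so halving lowers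
  by one the exponent that \<open>field_op\<close> gives to \<open>lam \<alpha>\<close>.\<close>

lemma log_measure_halves:
  assumes "std_dyadic_interval I"
  obtains m where "\<lfloor>log 2 (measure lborel I)\<rfloor> = - int m"
    and "\<lfloor>log 2 (measure lborel (left_half I))\<rfloor> = - int (Suc m)"
    and "\<lfloor>log 2 (measure lborel (right_half I))\<rfloor> = - int (Suc m)"
proof -
  have *: "\<lfloor>log 2 (measure lborel (dyadic_cell n b))\<rfloor> = - int n" for n b
  proof -
    have "measure lborel (dyadic_cell n b) = 1 / 2 ^ n"
      by (simp add: dyadic_cell_def divide_right_mono diff_divide_distrib[symmetric])
    then have "log 2 (measure lborel (dyadic_cell n b)) = of_int (- int n)"
      by (simp add: log_divide log_nat_power)
    then show ?thesis
      by (simp only: floor_of_int)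
  qed
  obtain m a where "I = dyadic_cell m a"
    using assms by (auto simp: std_dyadic_interval_iff)
  then show thesis
    using that[of m] * by (simp only: left_half_dyadic_cell right_half_dyadic_cell)
qed

section \<open>The refinement order on dyadic partitions\<close>

lemma dyadic_partitionsD:
  assumes "P \<in> dyadic_partitions"
  shows "finite P" "\<Union>P = {0..<1}" "{} \<notin> P" "\<And>I. I \<in> P \<Longrightarrow> std_dyadic_interval I"
    and "\<And>I J x. I \<in> P \<Longrightarrow> J \<in> P \<Longrightarrow> x \<in> I \<Longrightarrow> x \<in> J \<Longrightarrow> I = J"
  using assms by (auto simp: dyadic_partitions_def partition_on_def disjoint_def)

lemma dyadic_partitionsI:
  assumes "finite P" "\<Union>P = {0..<1}" "\<And>I. I \<in> P \<Longrightarrow> std_dyadic_interval I"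
    and "\<And>I J x. I \<in> P \<Longrightarrow> J \<in> P \<Longrightarrow> x \<in> I \<Longrightarrow> x \<in> J \<Longrightarrow> I = J"
  shows "P \<in> dyadic_partitions"
proof -
  have "disjoint P"
    unfolding disjoint_def using assms(4) by blast
  moreover have "{} \<notin> P"
    using assms(3) std_dyadic_interval_nonempty by blast
  ultimately show ?thesis
    using assms(1-3) by (simp add: dyadic_partitions_def partition_on_def)
qed

lemma coarser_iff:
  "P \<preceq> Q \<longleftrightarrow> P \<in> dyadic_partitions \<and> Q \<in> dyadic_partitions \<and> (\<forall>K\<in>Q. \<exists>I\<in>P. K \<subseteq> I)"
  by (auto simp: coarser_def refines_def dyadic_partitions_def)

lemma coarserD:
  assumes "P \<preceq> Q"
  shows "P \<in> dyadic_partitions" "Q \<in> dyadic_partitions"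
  using assms by (auto simp: coarser_iff)

lemma coarser_refl: "P \<in> dyadic_partitions \<Longrightarrow> P \<preceq> P"
  by (auto simp: coarser_iff)

lemma coarser_trans: "P \<preceq> Q \<Longrightarrow> Q \<preceq> R \<Longrightarrow> P \<preceq> R"
  unfolding coarser_iff by (meson order.trans)

text \<open>The nonempty pairwise intersections work: by nesting, each is one of the two intervals
  and hence again dyadic. This is the directedness of the index set.\<close>

lemma coarser_common_refinement:
  assumes P: "P \<in> dyadic_partitions" and Q: "Q \<in> dyadic_partitions"
  obtains R where "P \<preceq> R" "Q \<preceq> R"
proof -
  define R where "R = {A \<inter> B | A B. A \<in> P \<and> B \<in> Q \<and> A \<inter> B \<noteq> {}}"
  note P' = dyadic_partitionsD[OF P] and Q' = dyadic_partitionsD[OF Q]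
  have "R \<in> dyadic_partitions"
  proof (rule dyadic_partitionsI)
    have "R \<subseteq> (\<lambda>(A, B). A \<inter> B) ` (P \<times> Q)"
      by (auto simp: R_def)
    then show "finite R"
      using P'(1) Q'(1) finite_subset by blast
    have "\<Union>R = \<Union>P \<inter> \<Union>Q"
      by (auto simp: R_def)
    then show "\<Union>R = {0..<1}"
      using P'(2) Q'(2) by simp
  next
    fix I assume "I \<in> R"
    then obtain A B where AB: "I = A \<inter> B" "A \<in> P" "B \<in> Q" "A \<inter> B \<noteq> {}"
      by (auto simp: R_def)
    then have "I = A \<or> I = B"
      using std_dyadic_interval_nested[of A B] P'(4) Q'(4) by blast
    then show "std_dyadic_interval I"
      using AB P'(4) Q'(4) by auto
  next
    fix I J x assume "I \<in> R" "J \<in> R" "x \<in> I" "x \<in> J"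
    then obtain A B A' B' where "I = A \<inter> B" "A \<in> P" "B \<in> Q" "J = A' \<inter> B'" "A' \<in> P" "B' \<in> Q"
      by (auto simp: R_def)
    with \<open>x \<in> I\<close> \<open>x \<in> J\<close> P'(5)[of A A' x] Q'(5)[of B B' x] show "I = J"
      by auto
  qed
  moreover have "\<exists>I\<in>P. K \<subseteq> I" "\<exists>I\<in>Q. K \<subseteq> I" if "K \<in> R" for K
    using that by (auto simp: R_def)
  ultimately have "P \<preceq> R" "Q \<preceq> R"
    using P Q by (auto simp: coarser_iff)
  then show thesis
    by (rule that)
qed

text \<open>Sending each interval of \<open>Q\<close> to one of \<open>P\<close> containing it is
  onto \<open>P\<close>. Cardinality is the measure for the inductions along halvings.\<close>

lemma coarser_card_le:
  assumes "P \<preceq> Q"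
  shows "card P \<le> card Q"
proof -
  note P = dyadic_partitionsD[OF coarserD(1)[OF assms]]
    and Q = dyadic_partitionsD[OF coarserD(2)[OF assms]]
  have "\<exists>f. \<forall>K\<in>Q. f K \<in> P \<and> K \<subseteq> f K"
    using assms unfolding coarser_iff by (intro bchoice) auto
  then obtain f where f: "\<And>K. K \<in> Q \<Longrightarrow> f K \<in> P \<and> K \<subseteq> f K"
    by blast
  have "P \<subseteq> f ` Q"
  proof
    fix I assume "I \<in> P"
    then obtain x where "x \<in> I"
      using P(3) by fastforce
    then obtain K where "K \<in> Q" "x \<in> K"
      using P(2) Q(2) \<open>I \<in> P\<close> by blast
    then show "I \<in> f ` Q"
      using f[of K] P(5)[OF \<open>I \<in> P\<close> _ \<open>x \<in> I\<close>] by blast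
  qed
  then show ?thesis
    using Q(1) surj_card_le by blast
qed

section \<open>Halving one interval of a partition\<close>

lemma halves_notin:
  assumes P: "P \<in> dyadic_partitions" and "I \<in> P"
  shows "left_half I \<notin> P" "right_half I \<notin> P" "left_half I \<noteq> right_half I"
proof -
  note P' = dyadic_partitionsD[OF P]
  note I = P'(4)[OF \<open>I \<in> P\<close>]
  note h = halves_partition[OF I]
  obtain x y where xy: "x \<in> left_half I" "y \<in> right_half I"
    using std_dyadic_interval_halves[OF I] std_dyadic_interval_nonempty by blast
  then have "x \<in> I" "y \<in> I" "x \<notin> right_half I" "y \<notin> left_half I"
    using h by auto
  then show "left_half I \<notin> P" "right_half I \<notin> P" "left_half I \<noteq> right_half I"
    using P'(5)[OF \<open>I \<in> P\<close>, of _ x] P'(5)[OF \<open>I \<in> P\<close>, of _ y] xy by metis+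
qed

lemma halve_dyadic:
  assumes P: "P \<in> dyadic_partitions" and "I \<in> P"
  shows "halve P I \<in> dyadic_partitions"
proof (rule dyadic_partitionsI)
  note P' = dyadic_partitionsD[OF P]
  note I = P'(4)[OF \<open>I \<in> P\<close>]
  note h = halves_partition[OF I]
  show "finite (halve P I)"
    using P'(1) by (simp add: halve_def)
  have "\<Union>(halve P I) = \<Union>P"
    using h \<open>I \<in> P\<close> by (auto simp: halve_def)
  then show "\<Union>(halve P I) = {0..<1}"
    using P'(2) by simp
  show "std_dyadic_interval J" if "J \<in> halve P I" for J
    using that P'(4) std_dyadic_interval_halves[OF I] by (auto simp: halve_def)
  have half: "x \<in> I" if "x \<in> left_half I \<or> x \<in> right_half I" for x
    using that h by auto
  show "J = K" if "J \<in> halve P I" "K \<in> halve P I" "x \<in> J" "x \<in> K" for J K x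
    using that h half[of x] P'(5)[OF \<open>I \<in> P\<close>, of _ x] P'(5)[of J K x]
    by (auto simp: halve_def)
qed

lemma coarser_halve:
  assumes P: "P \<in> dyadic_partitions" and "I \<in> P"
  shows "P \<preceq> halve P I"
  using halves_partition[OF dyadic_partitionsD(4)[OF assms]] halve_dyadic[OF assms] assms
  unfolding coarser_iff halve_def by blast

lemma card_halve:
  assumes P: "P \<in> dyadic_partitions" and "I \<in> P"
  shows "card (halve P I) = Suc (card P)"
  using halves_notin[OF assms] dyadic_partitionsD(1)[OF P] \<open>I \<in> P\<close> card_Suc_Diff1[of P I]
  by (simp add: halve_def)

text \<open>An interval of \<open>Q\<close> inside \<open>I\<close> is a proper part of it, as
  \<open>I \<notin> Q\<close>, and so fits into one half. Halving an interval missing from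
  \<open>Q\<close> therefore never overshoots \<open>Q\<close>.\<close>

lemma halve_coarser:
  assumes "P \<preceq> Q" and "I \<in> P" and "I \<notin> Q"
  shows "halve P I \<preceq> Q"
proof -
  have "\<exists>J\<in>halve P I. K \<subseteq> J" if "K \<in> Q" for K
  proof -
    obtain X where "X \<in> P" "K \<subseteq> X"
      using assms(1) \<open>K \<in> Q\<close> by (auto simp: coarser_iff)
    show ?thesis
    proof (cases "X = I")
      case True
      then have "K \<subset> I"
        using \<open>K \<subseteq> X\<close> \<open>K \<in> Q\<close> \<open>I \<notin> Q\<close> by blast
      moreover have "std_dyadic_interval I" "std_dyadic_interval K"
        using assms(1,2) \<open>K \<in> Q\<close> dyadic_partitionsD(4) coarserD by metis+
      ultimately show ?thesis
        using psubset_std_dyadic_interval[of I K] by (auto simp: halve_def)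
    next
      case False
      then show ?thesis
        using \<open>X \<in> P\<close> \<open>K \<subseteq> X\<close> by (auto simp: halve_def)
    qed
  qed
  then show ?thesis
    using halve_dyadic[of P I] assms(2) coarserD[OF assms(1)] by (simp add: coarser_iff)
qed

text \<open>If \<open>P \<subseteq> Q\<close>, each interval of \<open>Q\<close> meets one of
  \<open>P\<close>, and disjointness within \<open>Q\<close> makes them equal. This supplies the
  next interval to halve on the way to \<open>Q\<close>.\<close>

lemma coarser_neq_obtains:
  assumes "P \<preceq> Q" and "P \<noteq> Q"
  obtains I where "I \<in> P" "I \<notin> Q"
proof -
  note P = dyadic_partitionsD[OF coarserD(1)[OF assms(1)]]
    and Q = dyadic_partitionsD[OF coarserD(2)[OF assms(1)]]
  have "Q \<subseteq> P" if "P \<subseteq> Q"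
  proof
    fix K assume "K \<in> Q"
    then obtain x where "x \<in> K"
      using Q(3) by fastforce
    then obtain I where "I \<in> P" "x \<in> I"
      using P(2) Q(2) \<open>K \<in> Q\<close> by blast
    then show "K \<in> P"
      using Q(5)[OF \<open>K \<in> Q\<close> _ \<open>x \<in> K\<close>] that by blast
  qed
  then show thesis
    using assms(2) that by blast
qed

lemma halve_commute:
  assumes P: "P \<in> dyadic_partitions" and "I \<in> P" "J \<in> P" "I \<noteq> J"
  shows "halve (halve P I) J = halve (halve P J) I"
  using halves_notin[OF P \<open>I \<in> P\<close>] halves_notin[OF P \<open>J \<in> P\<close>] assms
  unfolding halve_def by blast

section \<open>The two-interval partition that carries the vacuum\<close>

lemma halves_eq: "halves = {dyadic_cell 1 0, dyadic_cell 1 1}"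
  by (simp add: halves_def dyadic_cell_def)

lemma halves_dyadic: "halves \<in> dyadic_partitions"
proof (rule dyadic_partitionsI)
  show "std_dyadic_interval I" if "I \<in> halves" for I
  proof -
    have "0 < (2::nat) ^ 1" "1 < (2::nat) ^ 1"
      by simp_all
    then show ?thesis
      using that std_dyadic_interval_iff unfolding halves_eq by blast
  qed
qed (auto simp: halves_def)

text \<open>Every interval of \<open>P\<close> is a proper part of \<open>[0, 1)\<close> and so lies
  in one of its halves. This applies to partitions that support at least two points.\<close>

lemma halves_coarser:
  assumes P: "P \<in> dyadic_partitions" and "{0..<1} \<notin> P"
  shows "halves \<preceq> P"
proof -
  note P' = dyadic_partitionsD[OF P]
  have unit: "{0..<1} = dyadic_cell 0 0"
    by (simp add: dyadic_cell_def)
  then have unit_dyadic: "std_dyadic_interval {0..<1}"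
    unfolding std_dyadic_interval_iff by (intro exI[of _ 0]) simp
  have "\<exists>J\<in>halves. K \<subseteq> J" if "K \<in> P" for K
  proof -
    have "K \<subset> {0..<1}"
      using P'(2) that assms(2) by blast
    then have "K \<subseteq> left_half {0..<1} \<or> K \<subseteq> right_half {0..<1}"
      using psubset_std_dyadic_interval unit_dyadic P'(4)[OF that] by blast
    then show ?thesis
      unfolding unit left_half_dyadic_cell right_half_dyadic_cell by (auto simp: halves_eq)
  qed
  then show ?thesis
    using P halves_dyadic by (auto simp: coarser_iff)
qed

section \<open>Transition isometries\<close>

lemma configs_iff: "s \<in> configs P \<longleftrightarrow> (\<forall>J. J \<notin> P \<longrightarrow> s J = undefined)"
  by (auto simp: configs_def PiE_iff extensional_def)

lemma configs_upd: "s \<in> configs P \<Longrightarrow> I \<in> P \<Longrightarrow> s(I := i) \<in> configs P"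
  by (simp add: configs_iff)

lemma finite_configs: "finite P \<Longrightarrow> finite (configs P :: 'd::finite config set)"
  by (simp add: configs_def finite_PiE)

lemma apply_halving_in_hilbert: "apply_halving V P I \<psi> \<in> hilbert (halve P I)"
  by (simp add: apply_halving_def hilbert_def)

text \<open>The two copies of \<open>V\<close> act on different tensor factors. This is the local
  confluence behind path independence.\<close>

lemma apply_halving_commute:
  fixes V :: "complex^'d^('d::finite \<times> 'd)"
  assumes P: "P \<in> dyadic_partitions" and I: "I \<in> P" and J: "J \<in> P" and "I \<noteq> J"
  shows "apply_halving V (halve P I) J \<circ> apply_halving V P I =
    apply_halving V (halve P J) I \<circ> apply_halving V P J" (is "?lhs = ?rhs")
proof -
  have both: "(apply_halving V (halve P I) J \<circ> apply_halving V P I) \<psi> s =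
      (if s \<in> configs (halve (halve P I) J) then
        \<Sum>j\<in>UNIV. \<Sum>i\<in>UNIV. V $ (s (left_half J), s (right_half J)) $ j *
          (V $ (s (left_half I), s (right_half I)) $ i *
          \<psi> ((restrict s (P - {I, J}))(I := i, J := j))) else 0)"
    if I: "I \<in> P" and J: "J \<in> P" and "I \<noteq> J" for I J \<psi> s
  proof -
    note nI = halves_notin[OF P I] and nJ = halves_notin[OF P J]
    \<comment> \<open>The configuration on \<open>halve P I\<close> at which the outer halving, of
      \<open>J\<close>, evaluates its argument.\<close>
    define u where "u j = (restrict s (halve P I - {J}))(J := j)" for j
    have "u j \<in> configs (halve P I)" for j
      using J \<open>I \<noteq> J\<close> by (auto simp: u_def configs_iff halve_def)
    moreover have "u j (left_half I) = s (left_half I)" "u j (right_half I) = s (right_half I)" for j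
      using nI J by (auto simp: u_def halve_def)
    moreover have "(restrict (u j) (P - {I}))(I := i) = (restrict s (P - {I, J}))(I := i, J := j)"
      for i j
      using J \<open>I \<noteq> J\<close> by (auto simp: u_def halve_def fun_eq_iff)
    ultimately have "apply_halving V P I \<psi> (u j) =
        (\<Sum>i\<in>UNIV. V $ (s (left_half I), s (right_half I)) $ i *
          \<psi> ((restrict s (P - {I, J}))(I := i, J := j)))" for j
      by (simp add: apply_halving_def[of V P])
    then show ?thesis
      by (simp add: apply_halving_def[of V "halve P I"] u_def sum_distrib_left)
  qed
  show ?thesis
  proof (intro ext)
    fix \<psi> and s :: "'d config"
    \<comment> \<open>The two expansions given by \<open>both\<close> differ only in the order of
      the updates and of the summations.\<close>
    have twist: "(restrict s (P - {J, I}))(J := i, I := j) = (restrict s (P - {I, J}))(I := j, J := i)"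
      for i j
      using \<open>I \<noteq> J\<close> by (auto simp: fun_eq_iff)
    show "?lhs \<psi> s = ?rhs \<psi> s"
      unfolding both[OF I J \<open>I \<noteq> J\<close>] both[OF J I \<open>I \<noteq> J\<close>[symmetric]] halve_commute[OF assms]
      by (subst sum.swap) (simp only: twist mult.left_commute)
  qed
qed

section \<open>Sequences of halvings and their path independence\<close>

lemma halvings_coarser: "halvings V P Q T \<Longrightarrow> P \<in> dyadic_partitions \<Longrightarrow> P \<preceq> Q"
proof (induction rule: halvings.induct)
  case refl
  then show ?case by (rule coarser_refl)
next
  case (step Q T I)
  then show ?case
    using coarser_halve coarser_trans coarserD(2) by metis
qed

lemma halvings_comp:
  "halvings V Q R S \<Longrightarrow> halvings V P Q T \<Longrightarrow> halvings V P R (S \<circ> T)"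
proof (induction rule: halvings.induct)
  case refl
  then show ?case by simp
next
  case (step R S I)
  show ?case
    unfolding comp_assoc by (rule halvings.step[OF step.IH[OF step.prems] step.hyps(2)])
qed

text \<open>\<open>halvings\<close> appends steps at the end, whereas the uniqueness proof has to
  peel off the first one.\<close>

lemma halvings_first_step:
  assumes "halvings V P Q T"
  shows "(P = Q \<and> T = id) \<or>
    (\<exists>I\<in>P. \<exists>T'. halvings V (halve P I) Q T' \<and> T = T' \<circ> apply_halving V P I)"
  using assms
proof (induction rule: halvings.induct)
  case refl
  then show ?case by simp
next
  case (step Q T I)
  show ?case
    using step.IH
  proof (elim disjE conjE bexE exE)
    assume "P = Q" "T = id"
    then show ?thesis
      using step.hyps(2) halvings.refl[of V "halve P I"] by (metis id_comp comp_id)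
  next
    fix J T' assume "J \<in> P" "halvings V (halve P J) Q T'" "T = T' \<circ> apply_halving V P J"
    then show ?thesis
      using halvings.step[of V "halve P J" Q T' I] step.hyps(2) by (metis comp_assoc)
  qed
qed

text \<open>Any interval of \<open>P\<close> missing from \<open>Q\<close> may be halved first,
  which leaves fewer halvings to do.\<close>

lemma halvings_exists: "P \<preceq> Q \<Longrightarrow> \<exists>T. halvings V P Q T"
proof (induction "card Q - card P" arbitrary: P rule: less_induct)
  case less
  show ?case
  proof (cases "P = Q")
    case True
    then show ?thesis
      using halvings.refl by blast
  next
    case False
    then obtain I where I: "I \<in> P" "I \<notin> Q"
      using coarser_neq_obtains less.prems by blast
    note P = coarserD(1)[OF less.prems] and le = halve_coarser[OF less.prems I]
    \<comment> \<open>Subtraction truncates, so the drop relies on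
      \<open>card (halve P I) \<le> card Q\<close>.\<close>
    have "card Q - card (halve P I) < card Q - card P"
      using coarser_card_le[OF le] card_halve[OF P I(1)] by simp
    then obtain T where "halvings V (halve P I) Q T"
      using less.hyps le by blast
    moreover have "halvings V P (halve P I) (apply_halving V P I \<circ> id)"
      using halvings.step[OF halvings.refl I(1)] .
    ultimately show ?thesis
      using halvings_comp by blast
  qed
qed

lemma not_halve_coarser: "P \<in> dyadic_partitions \<Longrightarrow> I \<in> P \<Longrightarrow> \<not> halve P I \<preceq> P"
  using coarser_card_le[of "halve P I" P] card_halve[of P I] by auto

text \<open>A halved interval cannot reappear under refinement: it would have to sit inside one of
  its own halves or inside another, disjoint interval of \<open>P\<close>.\<close>

lemma halve_coarserD:
  assumes "P \<in> dyadic_partitions" "I \<in> P" "halve P I \<preceq> Q"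
  shows "I \<notin> Q"
proof
  assume "I \<in> Q"
  then obtain J where J: "J \<in> halve P I" "I \<subseteq> J"
    using assms(3) by (auto simp: coarser_iff)
  note P = dyadic_partitionsD[OF assms(1)]
  have I: "std_dyadic_interval I"
    using P(4) assms(2) .
  have "J \<noteq> left_half I" "J \<noteq> right_half I"
    using J(2) halves_partition(1)[OF I] halves_notin[OF assms(1,2)] assms(2)
    by (metis Un_upper1 Un_upper2 antisym)+
  then have "J \<in> P" "I \<noteq> J"
    using J(1) by (auto simp: halve_def)
  moreover obtain x where "x \<in> I"
    using std_dyadic_interval_nonempty[OF I] by blast
  ultimately show False
    using P(5)[OF assms(2), of J x] J(2) by blast
qed

text \<open>Two halving sequences that start with different intervals \<open>I\<close> and \<open>J\<close> are both compared with
  a sequence that starts by halving \<open>I\<close> and \<open>J\<close>.\<close>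

lemma halvings_unique:
  assumes "halvings V P Q S" "halvings V P Q T" "P \<in> dyadic_partitions"
  shows "S = T"
  using assms
proof (induction "card Q - card P" arbitrary: P S T rule: less_induct)
  case less
  note P = less.prems(3)
  show ?case
  proof (cases "P = Q")
    case True
    \<comment> \<open>A first halving is excluded, since refining further cannot lead back to
      \<open>P\<close>.\<close>
    then have "S = id" "T = id"
      using halvings_first_step[OF less.prems(1)] halvings_first_step[OF less.prems(2)]
        halvings_coarser halve_dyadic[OF P] not_halve_coarser[OF P] by blast+
    then show ?thesis by simp
  next
    case False
    obtain I S' where I: "I \<in> P" and S': "halvings V (halve P I) Q S'" "S = S' \<circ> apply_halving V P I"
      using halvings_first_step[OF less.prems(1)] False by blast
    obtain J T' where J: "J \<in> P" and T': "halvings V (halve P J) Q T'" "T = T' \<circ> apply_halving V P J"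
      using halvings_first_step[OF less.prems(2)] False by blast
    note PI = halve_dyadic[OF P I] and PJ = halve_dyadic[OF P J]
    have IH: "S1 = S2" if "K \<in> P" "halvings V (halve P K) Q S1" "halvings V (halve P K) Q S2" for K S1 S2
    proof (rule less.hyps[of "halve P K"])
      have "card (halve P K) \<le> card Q"
        using coarser_card_le halvings_coarser that halve_dyadic[OF P] by blast
      then show "card Q - card (halve P K) < card Q - card P"
        using card_halve[OF P \<open>K \<in> P\<close>] by simp
    qed (use that halve_dyadic[OF P] in auto)
    show ?thesis
    proof (cases "I = J")
      case True
      then show ?thesis
        using IH[OF I] S' T' by blast
    next
      case False
      define R where "R = halve (halve P I) J"
      have R: "R = halve (halve P J) I"
        unfolding R_def by (rule halve_commute[OF P I J False])
      have J': "J \<in> halve P I" and I': "I \<in> halve P J"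
        using I J False by (auto simp: halve_def)
      \<comment> \<open>The second sequence starts by halving \<open>J\<close>, so \<open>J\<close>
        is absent from \<open>Q\<close> and may also be halved right after \<open>I\<close>.\<close>
      have "J \<notin> Q"
        using halve_coarserD[OF P J halvings_coarser[OF T'(1) PJ]] .
      then have "R \<preceq> Q"
        unfolding R_def using halve_coarser[OF halvings_coarser[OF S'(1) PI] J'] by simp
      then obtain U where U: "halvings V R Q U"
        using halvings_exists by blast
      \<comment> \<open>By the induction hypothesis, \<open>S'\<close> and \<open>T'\<close> both
        factor through the common continuation \<open>U\<close>; commuting the two initial halvings
        then closes the square.\<close>
      have "halvings V (halve P I) R (apply_halving V (halve P I) J \<circ> id)"
        unfolding R_def by (rule halvings.step[OF halvings.refl J'])
      then have "S' = U \<circ> apply_halving V (halve P I) J"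
        using IH[OF I S'(1)] halvings_comp[OF U] by simp
      moreover have "halvings V (halve P J) R (apply_halving V (halve P J) I \<circ> id)"
        unfolding R by (rule halvings.step[OF halvings.refl I'])
      then have "T' = U \<circ> apply_halving V (halve P J) I"
        using IH[OF J T'(1)] halvings_comp[OF U] by simp
      ultimately show ?thesis
        using S'(2) T'(2) apply_halving_commute[OF P I J False, of V] by (simp add: comp_assoc)
    qed
  qed
qed

section \<open>Transition maps between a partition and its refinements\<close>

lemma transition_eqI:
  assumes "halvings V P Q T" "P \<in> dyadic_partitions"
  shows "transition V P Q = T"
  unfolding transition_def using assms halvings_unique by blast

lemma halvings_transition:
  assumes "P \<preceq> Q"
  shows "halvings V P Q (transition V P Q)"
  using halvings_exists[OF assms, of V] transition_eqI coarserD(1)[OF assms] by metis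

lemma transition_trans:
  assumes "P \<preceq> Q" "Q \<preceq> R"
  shows "transition V P R = transition V Q R \<circ> transition V P Q"
  using transition_eqI[OF halvings_comp] halvings_transition assms coarserD(1) by metis

lemma transition_in_hilbert:
  assumes "P \<preceq> Q" and "\<psi> \<in> hilbert P"
  shows "transition V P Q \<psi> \<in> hilbert Q"
  using halvings_transition[OF assms(1), of V] assms(2)
proof (cases rule: halvings.cases)
  case refl
  then show ?thesis
    using assms(2) by simp
next
  case (step Q T I)
  then show ?thesis
    using apply_halving_in_hilbert by simp
qed

section \<open>Local operators under halving\<close>

lemma sum_configs_insert:
  assumes "I \<notin> P"
  shows "(\<Sum>s\<in>configs (insert I P). f s) = (\<Sum>r\<in>configs P. \<Sum>i\<in>UNIV. f (r(I := i)))"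
proof -
  have "(\<Sum>s\<in>configs (insert I P). f s) =
      (\<Sum>(i, r)\<in>UNIV \<times> configs P. f (r(I := i)))"
    unfolding configs_def PiE_insert_eq
    by (subst sum.reindex[OF inj_combinator[OF assms]]) (simp add: case_prod_beta comp_def)
  also have "\<dots> = (\<Sum>i\<in>UNIV. \<Sum>r\<in>configs P. f (r(I := i)))"
    by (simp add: sum.cartesian_product)
  finally show ?thesis
    by (subst sum.swap)
qed

lemma sum_configs_remove:
  assumes "I \<in> P"
  shows "(\<Sum>s\<in>configs P. f s) = (\<Sum>r\<in>configs (P - {I}). \<Sum>i\<in>UNIV. f (r(I := i)))"
  using sum_configs_insert[of I "P - {I}" f] assms by (simp add: insert_absorb)

lemma sum_configs_halve:
  assumes "P \<in> dyadic_partitions" and "I \<in> P"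
  shows "(\<Sum>s\<in>configs (halve P I). f s) =
    (\<Sum>r\<in>configs (P - {I}). \<Sum>a\<in>UNIV. \<Sum>b\<in>UNIV. f (r(left_half I := a, right_half I := b)))"
proof -
  note n = halves_notin[OF assms]
  have "halve P I = insert (right_half I) (insert (left_half I) (P - {I}))"
    by (auto simp: halve_def)
  then show ?thesis
    using n by (simp add: sum_configs_insert)
qed

text \<open>Covers exactly the configurations over which \<open>sum_configs_halve\<close> sums, with
  \<open>r\<close> holding the factors other than \<open>I\<close>.\<close>

lemma apply_halving_upd:
  assumes "P \<in> dyadic_partitions" and "I \<in> P" and r: "r \<in> configs (P - {I})"
  shows "apply_halving V P I \<psi> (r(left_half I := a, right_half I := b)) =
    (\<Sum>i\<in>UNIV. V $ (a, b) $ i * \<psi> (r(I := i)))"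
proof -
  note n = halves_notin[OF assms(1,2)]
  let ?s = "r(left_half I := a, right_half I := b)"
  have "?s \<in> configs (halve P I)"
    using r by (auto simp: configs_iff halve_def)
  moreover have "(restrict ?s (P - {I}))(I := i) = r(I := i)" for i
    using r n by (auto simp: configs_iff fun_eq_iff)
  ultimately show ?thesis
    using n by (simp add: apply_halving_def)
qed

text \<open>Membership in \<open>hilbert P\<close> enters because \<open>local_op\<close> sets all
  coefficients outside \<open>configs P\<close> to zero.\<close>

lemma local_op_mat_1:
  assumes "I \<in> P" and "\<psi> \<in> hilbert P"
  shows "local_op P (mat 1) I \<psi> = \<psi>"
proof
  fix s
  have "(if s I = k then 1 else 0) * \<psi> (s(I := k)) = (if s I = k then \<psi> s else 0)" for k
    by auto
  then have "local_op P (mat 1) I \<psi> s = (if s \<in> configs P then \<psi> s else 0)"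
    by (simp add: local_op_def mat_def)
  then show "local_op P (mat 1) I \<psi> s = \<psi> s"
    using assms(2) by (auto simp: hilbert_def)
qed

lemma local_op_commute:
  assumes "I \<in> P" "J \<in> P" "I \<noteq> J"
  shows "local_op P A I (local_op P B J \<psi>) = local_op P B J (local_op P A I \<psi>)"
proof
  fix s
  show "local_op P A I (local_op P B J \<psi>) s = local_op P B J (local_op P A I \<psi>) s"
  proof (cases "s \<in> configs P")
    case True
    then have "local_op P A I (local_op P B J \<psi>) s =
        (\<Sum>i\<in>UNIV. \<Sum>j\<in>UNIV. A $ s I $ i * (B $ s J $ j * \<psi> (s(I := i, J := j))))"
      using assms by (simp add: local_op_def configs_upd sum_distrib_left)
    also have "\<dots> = local_op P B J (local_op P A I \<psi>) s"
      using assms True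
      by (subst sum.swap)
        (simp add: local_op_def configs_upd sum_distrib_left mult.left_commute fun_upd_twist)
    finally show ?thesis .
  qed (simp add: local_op_def)
qed

lemma local_op_scale: "local_op P A I (\<lambda>s. c * \<psi> s) = (\<lambda>s. c * local_op P A I \<psi> s)"
  by (auto simp: local_op_def sum_distrib_left mult.left_commute)

lemma apply_halving_scale: "apply_halving V P I (\<lambda>s. c * \<psi> s) = (\<lambda>s. c * apply_halving V P I \<psi> s)"
  by (auto simp: apply_halving_def sum_distrib_left mult.left_commute)

lemma cinner_scale: "cinner P \<phi> (\<lambda>s. c * \<psi> s) = c * cinner P \<phi> \<psi>"
  by (simp add: cinner_def sum_distrib_left mult.left_commute)

lemma local_op_scale_mat: "local_op P (cmat_scale c A) I \<psi> = (\<lambda>s. c * local_op P A I \<psi> s)"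
  by (auto simp: local_op_def cmat_scale_def sum_distrib_left mult.assoc)

text \<open>\<open>A\<close> and \<open>V\<close> act on different tensor factors, and
  \<open>J\<close> is still an interval after the halving of \<open>I\<close>.\<close>

lemma local_op_apply_halving:
  assumes P: "P \<in> dyadic_partitions" and I: "I \<in> P" and J: "J \<in> P" "J \<noteq> I"
  shows "local_op (halve P I) A J (apply_halving V P I \<psi>) = apply_halving V P I (local_op P A J \<psi>)"
proof
  fix s
  note n = halves_notin[OF P I]
  have neq: "left_half I \<noteq> J" "right_half I \<noteq> J"
    using n J by auto
  show "local_op (halve P I) A J (apply_halving V P I \<psi>) s = apply_halving V P I (local_op P A J \<psi>) s"
  proof (cases "s \<in> configs (halve P I)")
    case True
    have upd: "(restrict (s(J := k)) (P - {I}))(I := i) = (restrict s (P - {I}))(I := i, J := k)" for i k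
      using J by (auto simp: fun_eq_iff)
    have conf: "(restrict s (P - {I}))(I := i) \<in> configs P" for i
      using I by (auto simp: configs_iff)
    have "local_op (halve P I) A J (apply_halving V P I \<psi>) s =
        (\<Sum>k\<in>UNIV. \<Sum>i\<in>UNIV. A $ s J $ k * (V $ (s (left_half I), s (right_half I)) $ i *
          \<psi> ((restrict s (P - {I}))(I := i, J := k))))"
      using True J neq
      by (simp add: local_op_def apply_halving_def configs_upd halve_def upd sum_distrib_left)
    also have "\<dots> = apply_halving V P I (local_op P A J \<psi>) s"
      using True J neq conf
      by (subst sum.swap)
        (simp add: local_op_def apply_halving_def sum_distrib_left mult.left_commute)
    finally show ?thesis .
  qed (simp add: local_op_def apply_halving_def)
qed

section \<open>The ascending channel as compression by one halving\<close>

lemma sum_UNIV_prod: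
  "(\<Sum>p\<in>UNIV. f p) = (\<Sum>a\<in>(UNIV :: 'a::finite set). \<Sum>b\<in>(UNIV :: 'b::finite set). f (a, b))"
  by (simp add: sum.cartesian_product)

text \<open>The identity on the second tensor factor collapses one index sum, so both entries of
  \<open>V\<close> share the index \<open>b\<close>.\<close>

lemma ascend_entry:
  "ascend V A $ i $ j = (\<Sum>a\<in>UNIV. \<Sum>b\<in>UNIV. \<Sum>c\<in>UNIV. cnj (V $ (a, b) $ i) * (A $ a $ c * V $ (c, b) $ j))"
proof -
  have "(kronecker A (mat 1) ** V) $ (a, b) $ j = (\<Sum>c\<in>UNIV. A $ a $ c * V $ (c, b) $ j)" for a b
  proof -
    have "(kronecker A (mat 1) ** V) $ (a, b) $ j =
        (\<Sum>c\<in>UNIV. \<Sum>e\<in>UNIV. if b = e then A $ a $ c * V $ (c, e) $ j else 0)"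
      unfolding matrix_matrix_mult_def sum_UNIV_prod kronecker_def mat_def vec_lambda_beta fst_conv snd_conv
      by (intro sum.cong) simp_all
    then show ?thesis
      by simp
  qed
  moreover have "ascend V A $ i $ j =
      (\<Sum>a\<in>UNIV. \<Sum>b\<in>UNIV. cnj (V $ (a, b) $ i) * (kronecker A (mat 1) ** V) $ (a, b) $ j)"
    unfolding ascend_def matrix_mul_assoc[symmetric]
    by (subst matrix_matrix_mult_def) (simp add: sum_UNIV_prod cadjoint_def)
  ultimately show ?thesis
    by (simp add: sum_distrib_left)
qed

lemma cinner_local_op:
  assumes "I \<in> P"
  shows "cinner P \<phi> (local_op P A I \<psi>) = (\<Sum>r\<in>configs (P - {I}). \<Sum>i\<in>UNIV. \<Sum>j\<in>UNIV.
    cnj (\<phi> (r(I := i))) * (A $ i $ j * \<psi> (r(I := j))))"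
proof -
  have "r(I := i) \<in> configs P" if "r \<in> configs (P - {I})" for r i
    using that assms by (auto simp: configs_iff)
  then show ?thesis
    using assms by (simp add: cinner_def sum_configs_remove local_op_def sum_distrib_left cong: sum.cong)
qed

text \<open>With the other factors frozen in \<open>r\<close>, both sides are the same fivefold sum
  over the indices of \<open>V\<close> and \<open>A\<close>. Working with matrix elements avoids
  constructing an adjoint of \<open>apply_halving\<close>.\<close>

lemma cinner_local_op_left_half:
  assumes P: "P \<in> dyadic_partitions" and I: "I \<in> P"
  shows "cinner (halve P I) (apply_halving V P I \<phi>)
      (local_op (halve P I) A (left_half I) (apply_halving V P I \<psi>)) =
    cinner P \<phi> (local_op P (ascend V A) I \<psi>)"
proof -
  note n = halves_notin[OF P I]
  let ?l = "left_half I" and ?r = "right_half I"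
  have conf: "r(?l := a, ?r := b) \<in> configs (halve P I)" if "r \<in> configs (P - {I})" for r a b
    using that by (auto simp: configs_iff halve_def)
  have upd: "r(?l := a, ?r := b, ?l := c) = r(?l := c, ?r := b)" for r and a b c :: 'a
    using n(3) by (metis fun_upd_twist fun_upd_upd)
  have "cinner (halve P I) (apply_halving V P I \<phi>)
      (local_op (halve P I) A ?l (apply_halving V P I \<psi>)) =
    (\<Sum>r\<in>configs (P - {I}). \<Sum>a\<in>UNIV. \<Sum>b\<in>UNIV.
      (\<Sum>i\<in>UNIV. cnj (V $ (a, b) $ i) * cnj (\<phi> (r(I := i)))) *
      (\<Sum>c\<in>UNIV. A $ a $ c * (\<Sum>j\<in>UNIV. V $ (c, b) $ j * \<psi> (r(I := j)))))"
    using n by (simp add: cinner_def sum_configs_halve[OF P I] local_op_def conf upd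
        apply_halving_upd[OF P I] cong: sum.cong)
  also have "\<dots> = (\<Sum>r\<in>configs (P - {I}). \<Sum>i\<in>UNIV. \<Sum>j\<in>UNIV.
    cnj (\<phi> (r(I := i))) * (ascend V A $ i $ j * \<psi> (r(I := j))))"
  proof (rule sum.cong[OF HOL.refl])
    fix r
    let ?t = "\<lambda>a b i c j. cnj (\<phi> (r(I := i))) *
      (cnj (V $ (a, b) $ i) * (A $ a $ c * V $ (c, b) $ j) * \<psi> (r(I := j)))"
    have "(\<Sum>a\<in>UNIV. \<Sum>b\<in>UNIV. (\<Sum>i\<in>UNIV. cnj (V $ (a, b) $ i) * cnj (\<phi> (r(I := i)))) *
        (\<Sum>c\<in>UNIV. A $ a $ c * (\<Sum>j\<in>UNIV. V $ (c, b) $ j * \<psi> (r(I := j))))) =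
        (\<Sum>a\<in>UNIV. \<Sum>b\<in>UNIV. \<Sum>i\<in>UNIV. \<Sum>c\<in>UNIV. \<Sum>j\<in>UNIV. ?t a b i c j)"
      unfolding sum_product by (simp add: sum_distrib_left mult_ac)
    also have "\<dots> = (\<Sum>a\<in>UNIV. \<Sum>b\<in>UNIV. \<Sum>i\<in>UNIV. \<Sum>j\<in>UNIV. \<Sum>c\<in>UNIV. ?t a b i c j)"
      by (subst (4) sum.swap) rule
    also have "\<dots> = (\<Sum>i\<in>UNIV. \<Sum>j\<in>UNIV. \<Sum>a\<in>UNIV. \<Sum>b\<in>UNIV. \<Sum>c\<in>UNIV. ?t a b i c j)"
    proof -
      \<comment> \<open>Grouping the indices into pairs reduces this to a single interchange of two
        sums.\<close>
      have "(\<Sum>a\<in>UNIV. \<Sum>b\<in>UNIV. \<Sum>i\<in>UNIV. \<Sum>j\<in>UNIV. F a b i j) =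
        (\<Sum>i\<in>UNIV. \<Sum>j\<in>UNIV. \<Sum>a\<in>UNIV. \<Sum>b\<in>UNIV. F a b i j)" for F :: "'a \<Rightarrow> 'a \<Rightarrow> 'a \<Rightarrow> 'a \<Rightarrow> complex"
        using sum.swap[of "\<lambda>p q. F (fst p) (snd p) (fst q) (snd q)" UNIV UNIV]
        by (simp add: sum_UNIV_prod)
      then show ?thesis .
    qed
    also have "\<dots> = (\<Sum>i\<in>UNIV. \<Sum>j\<in>UNIV.
        cnj (\<phi> (r(I := i))) * (ascend V A $ i $ j * \<psi> (r(I := j))))"
      by (simp add: ascend_entry sum_distrib_left sum_distrib_right)
    finally show "(\<Sum>a\<in>UNIV. \<Sum>b\<in>UNIV. (\<Sum>i\<in>UNIV. cnj (V $ (a, b) $ i) * cnj (\<phi> (r(I := i)))) *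
        (\<Sum>c\<in>UNIV. A $ a $ c * (\<Sum>j\<in>UNIV. V $ (c, b) $ j * \<psi> (r(I := j))))) =
      (\<Sum>i\<in>UNIV. \<Sum>j\<in>UNIV. cnj (\<phi> (r(I := i))) * (ascend V A $ i $ j * \<psi> (r(I := j))))" .
  qed
  also have "\<dots> = cinner P \<phi> (local_op P (ascend V A) I \<psi>)"
    by (simp add: cinner_local_op[OF I])
  finally show ?thesis .
qed

text \<open>Applying the symmetry to a basis vector reads off a column of \<open>V\<close>.\<close>

lemma swap_symmetric_entry:
  assumes "\<And>v. swap_factors (V *v v) = V *v v"
  shows "V $ (b, a) $ i = V $ (a, b) $ i"
proof -
  have "(V *v axis i 1) $ p = V $ p $ i" for p
    by (simp add: matrix_vector_mult_def axis_def if_distrib[of "\<lambda>x. _ * x"] cong: if_cong)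
  then show ?thesis
    using assms[of "axis i 1"] by (simp add: vec_eq_iff swap_factors_def)
qed

lemma cinner_local_op_right_half:
  assumes P: "P \<in> dyadic_partitions" and I: "I \<in> P"
    and sym: "\<And>v. swap_factors (V *v v) = V *v v"
  shows "cinner (halve P I) (apply_halving V P I \<phi>)
      (local_op (halve P I) A (right_half I) (apply_halving V P I \<psi>)) =
    cinner P \<phi> (local_op P (ascend V A) I \<psi>)"
proof -
  note n = halves_notin[OF P I]
  let ?l = "left_half I" and ?r = "right_half I"
  have conf: "r(?l := a, ?r := b) \<in> configs (halve P I)" if "r \<in> configs (P - {I})" for r a b
    using that by (auto simp: configs_iff halve_def)
  have upd: "r(?l := a, ?r := b, ?l := c) = r(?l := c, ?r := b)" for r and a b c :: 'a
    using n(3) by (metis fun_upd_twist fun_upd_upd)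
  note eqs = cinner_def sum_configs_halve[OF P I] local_op_def conf upd apply_halving_upd[OF P I]
  have "cinner (halve P I) (apply_halving V P I \<phi>)
      (local_op (halve P I) A ?r (apply_halving V P I \<psi>)) =
    (\<Sum>r\<in>configs (P - {I}). \<Sum>a\<in>UNIV. \<Sum>b\<in>UNIV.
      (\<Sum>i\<in>UNIV. cnj (V $ (a, b) $ i) * cnj (\<phi> (r(I := i)))) *
      (\<Sum>c\<in>UNIV. A $ b $ c * (\<Sum>j\<in>UNIV. V $ (a, c) $ j * \<psi> (r(I := j)))))"
    using n by (simp add: eqs cong: sum.cong)
  \<comment> \<open>The symmetry of \<open>V\<close> moves \<open>b\<close>, the index on which
    \<open>A\<close> acts, to the left factor. Up to renaming this is the sum for the left
    half.\<close>
  also have "\<dots> = (\<Sum>r\<in>configs (P - {I}). \<Sum>b\<in>UNIV. \<Sum>a\<in>UNIV.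
      (\<Sum>i\<in>UNIV. cnj (V $ (b, a) $ i) * cnj (\<phi> (r(I := i)))) *
      (\<Sum>c\<in>UNIV. A $ b $ c * (\<Sum>j\<in>UNIV. V $ (c, a) $ j * \<psi> (r(I := j)))))"
    by (subst (2) sum.swap) (simp only: swap_symmetric_entry[of V, OF sym])
  also have "\<dots> = cinner (halve P I) (apply_halving V P I \<phi>)
      (local_op (halve P I) A ?l (apply_halving V P I \<psi>))"
    using n by (simp add: eqs cong: sum.cong)
  also have "\<dots> = cinner P \<phi> (local_op P (ascend V A) I \<psi>)"
    by (rule cinner_local_op_left_half[OF P I])
  finally show ?thesis .
qed

lemma ascend_mat_1:
  assumes "isometry V"
  shows "ascend V (mat 1) = mat 1"
proof -
  have "kronecker (mat 1) (mat 1) = (mat 1 :: complex^('a \<times> 'a)^('a \<times> 'a))"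
    by (auto simp: kronecker_def mat_def vec_eq_iff)
  then show ?thesis
    using assms by (simp add: ascend_def isometry_def)
qed

text \<open>The case \<open>A = mat 1\<close> of the left-half relation; \<open>ascend V\<close> is
  unital because \<open>V\<close> is an isometry.\<close>

lemma cinner_apply_halving:
  assumes P: "P \<in> dyadic_partitions" and I: "I \<in> P" and V: "isometry V"
  shows "cinner (halve P I) (apply_halving V P I \<phi>) (apply_halving V P I \<psi>) = cinner P \<phi> \<psi>"
proof -
  \<comment> \<open>True for arbitrary \<open>\<psi>\<close>, since \<open>cinner P\<close> reads
    coefficients on \<open>configs P\<close> only.\<close>
  have "cinner P \<phi> (local_op P (mat 1) I \<psi>) = cinner P \<phi> \<psi>"
    using I by (simp add: cinner_def local_op_def mat_def if_distrib[of "\<lambda>x. x * _"] cong: if_cong)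
  then show ?thesis
    using cinner_local_op_left_half[OF P I, of V \<phi> "mat 1" \<psi>] ascend_mat_1[OF V]
      local_op_mat_1[OF _ apply_halving_in_hilbert, of "left_half I" P I V \<psi>]
    by (simp add: halve_def)
qed

section \<open>Vacuum representatives\<close>

lemma cinner_transition:
  assumes "P \<preceq> Q" and V: "isometry V"
  shows "cinner Q (transition V P Q \<phi>) (transition V P Q \<psi>) = cinner P \<phi> \<psi>"
proof -
  have "cinner Q (T \<phi>) (T \<psi>) = cinner P \<phi> \<psi>" if "halvings V P Q T" for T
    using that
  proof (induction rule: halvings.induct)
    case (step Q T I)
    then show ?case
      using cinner_apply_halving[OF _ _ V, of Q I] coarserD(2)[OF halvings_coarser]
        coarserD(1)[OF assms(1)] by (metis comp_apply)
  qed simp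
  then show ?thesis
    using halvings_transition[OF assms(1)] by blast
qed

text \<open>Inner products survive the transition, and pairing with \<open>ket t\<close> recovers
  the coefficient at \<open>t\<close>.\<close>

lemma transition_inj:
  assumes "P \<preceq> Q" and V: "isometry V"
    and "\<psi> \<in> hilbert P" "\<psi>' \<in> hilbert P" and eq: "transition V P Q \<psi> = transition V P Q \<psi>'"
  shows "\<psi> = \<psi>'"
proof
  fix t :: "real set \<Rightarrow> 'a"
  have fin: "finite (configs P :: 'a config set)"
    using finite_configs dyadic_partitionsD(1)[OF coarserD(1)[OF assms(1)]] .
  \<comment> \<open>For \<open>t\<close> outside \<open>configs P\<close> both sides vanish: the sum
    never meets \<open>t\<close>, and \<open>\<phi> \<in> hilbert P\<close> gives
    \<open>\<phi> t = 0\<close>.\<close>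
  have ket: "cinner P (ket t) \<phi> = \<phi> t" if "\<phi> \<in> hilbert P" for \<phi>
  proof -
    have "cnj (ket t s) * \<phi> s = (if t = s then \<phi> s else 0)" for s
      by (simp add: ket_def)
    then show ?thesis
      using fin that by (simp add: cinner_def hilbert_def)
  qed
  have "cinner P (ket t) \<psi> = cinner P (ket t) \<psi>'"
    using cinner_transition[OF assms(1) V] eq by metis
  then show "\<psi> t = \<psi>' t"
    using ket assms(3,4) by simp
qed

text \<open>A vector and its image under a transition are identified in the direct limit, by
  functoriality of the transitions.\<close>

lemma limit_class_transition:
  assumes PQ: "P \<preceq> Q" and "\<psi> \<in> hilbert P"
  shows "limit_class V Q (transition V P Q \<psi>) = limit_class V P \<psi>"
proof -
  have "(\<exists>R. Q \<preceq> R \<and> S \<preceq> R \<and> transition V Q R (transition V P Q \<psi>) = transition V S R \<phi>) \<longleftrightarrow>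
    (\<exists>R. P \<preceq> R \<and> S \<preceq> R \<and> transition V P R \<psi> = transition V S R \<phi>)"
    (is "?lhs \<longleftrightarrow> ?rhs") for S \<phi>
  proof
    assume ?lhs
    then show ?rhs
      using coarser_trans[OF PQ] transition_trans[OF PQ] by (metis comp_apply)
  next
    assume ?rhs
    then obtain R where R: "P \<preceq> R" "S \<preceq> R" "transition V P R \<psi> = transition V S R \<phi>"
      by blast
    \<comment> \<open>The witness \<open>R\<close> need not refine \<open>Q\<close>, so the equality
      is pushed on to a common refinement of both.\<close>
    obtain R' where R': "R \<preceq> R'" "Q \<preceq> R'"
      using coarser_common_refinement[OF coarserD(2)[OF R(1)] coarserD(2)[OF PQ]] .
    have "transition V Q R' (transition V P Q \<psi>) = transition V P R' \<psi>"
      using transition_trans[OF PQ R'(2), of V] by simp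
    also have "\<dots> = transition V R R' (transition V S R \<phi>)"
      using transition_trans[OF R(1) R'(1), of V] R(3) by simp
    also have "\<dots> = transition V S R' \<phi>"
      using transition_trans[OF R(2) R'(1), of V] by simp
    finally show ?lhs
      using R'(2) coarser_trans[OF R(2) R'(1)] by blast
  qed
  then show ?thesis
    by (simp add: limit_class_def)
qed

text \<open>Injectivity of \<open>hilbert P\<close> into the direct limit; it makes the description
  in \<open>vacuum_rep\<close> unique.\<close>

lemma limit_class_eqD:
  assumes P: "P \<in> dyadic_partitions" and V: "isometry V"
    and "\<psi> \<in> hilbert P" "\<psi>' \<in> hilbert P" and "limit_class V P \<psi> = limit_class V P \<psi>'"
  shows "\<psi> = \<psi>'"
proof -
  have "(P, \<psi>) \<in> limit_class V P \<psi>"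
    using P assms(3) coarser_refl[OF P] by (auto simp: limit_class_def)
  then have "(P, \<psi>) \<in> limit_class V P \<psi>'"
    by (simp only: assms(5))
  then obtain R where "P \<preceq> R" "transition V P R \<psi>' = transition V P R \<psi>"
    by (auto simp: limit_class_def)
  then show ?thesis
    using transition_inj[OF _ V] assms(3,4) by metis
qed

lemma vacuum_rep_eqI:
  assumes "P \<in> dyadic_partitions" and "isometry V"
    and "\<psi> \<in> hilbert P" and "limit_class V P \<psi> = vacuum V"
  shows "vacuum_rep V P = \<psi>"
  unfolding vacuum_rep_def using assms limit_class_eqD[OF assms(1,2)] by (intro the_equality) auto

text \<open>The image of a representative has the same class, and uniqueness on \<open>Q\<close>
  identifies it with \<open>vacuum_rep V Q\<close>.\<close>

lemma vacuum_rep_refine: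
  assumes PQ: "P \<preceq> Q" and V: "isometry V" and "has_vacuum_rep V P"
  shows "has_vacuum_rep V Q" and "vacuum_rep V Q = transition V P Q (vacuum_rep V P)"
proof -
  obtain \<psi> where \<psi>: "\<psi> \<in> hilbert P" "limit_class V P \<psi> = vacuum V"
    using assms(3) by (auto simp: has_vacuum_rep_def)
  have "transition V P Q \<psi> \<in> hilbert Q" "limit_class V Q (transition V P Q \<psi>) = vacuum V"
    using transition_in_hilbert[OF PQ \<psi>(1)] limit_class_transition[OF PQ \<psi>(1)] \<psi>(2) by simp_all
  then show "has_vacuum_rep V Q" "vacuum_rep V Q = transition V P Q (vacuum_rep V P)"
    using vacuum_rep_eqI[OF coarserD(1)[OF PQ] V \<psi>] vacuum_rep_eqI[OF coarserD(2)[OF PQ] V]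
    by (auto simp: has_vacuum_rep_def)
qed

text \<open>The vacuum is by definition the class of \<open>vacuum_2\<close>, so only the support of
  its coefficients is to be checked.\<close>

lemma has_vacuum_rep_halves:
  fixes V :: "complex^'d^('d::finite \<times> 'd)"
  shows "has_vacuum_rep V halves"
proof -
  have "restrict (\<lambda>_. j) halves \<in> configs halves" for j :: 'd
    by (simp add: configs_iff)
  then have "vacuum_2 s = 0" if "s \<notin> configs halves" for s :: "'d config"
    using that by (auto simp: vacuum_2_def ket_def intro!: sum.neutral)
  then have "(vacuum_2 :: 'd state) \<in> hilbert halves"
    by (simp add: hilbert_def)
  then show ?thesis
    unfolding has_vacuum_rep_def vacuum_def by (rule bexI[where x = vacuum_2, rotated]) (rule HOL.refl)
qed

section \<open>Field operators under refinement\<close>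

text \<open>Disjointness of the partition leaves a single nonzero indicator in the sum.\<close>

lemma field_op_eq:
  assumes Q: "Q \<in> dyadic_partitions" and I: "I \<in> Q" and "z \<in> I"
  shows "field_op lam \<mu> \<alpha> Q z \<psi> =
    (\<lambda>s. lam \<alpha> powi \<lfloor>log 2 (measure lborel I)\<rfloor> * local_op Q (\<mu> \<alpha>) I \<psi> s)"
proof
  fix s
  note Q' = dyadic_partitionsD[OF Q]
  have "indicator J z = (if J = I then 1 else 0 :: complex)" if "J \<in> Q" for J
  proof (cases "J = I")
    case False
    then have "z \<notin> J"
      using Q'(5)[OF that I _ \<open>z \<in> I\<close>] by blast
    then show ?thesis
      using False by simp
  qed (use \<open>z \<in> I\<close> in simp)
  then have "field_op lam \<mu> \<alpha> Q z \<psi> s = (\<Sum>J\<in>Q. if J = I then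
      lam \<alpha> powi \<lfloor>log 2 (measure lborel J)\<rfloor> * local_op Q (\<mu> \<alpha>) J \<psi> s else 0)"
    unfolding field_op_def by (intro sum.cong) auto
  then show "field_op lam \<mu> \<alpha> Q z \<psi> s =
      lam \<alpha> powi \<lfloor>log 2 (measure lborel I)\<rfloor> * local_op Q (\<mu> \<alpha>) I \<psi> s"
    using Q'(1) I by simp
qed

lemma field_op_commute:
  assumes Q: "Q \<in> dyadic_partitions" and I: "I \<in> Q" and x: "x \<in> I" and y: "y \<in> {0..<1} - I"
  shows "field_op lam \<mu> \<alpha> Q x (field_op lam \<mu> \<beta> Q y \<psi>) =
    field_op lam \<mu> \<beta> Q y (field_op lam \<mu> \<alpha> Q x \<psi>)"
proof -
  obtain J where J: "J \<in> Q" "y \<in> J"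
    using y dyadic_partitionsD(2)[OF Q] by blast
  then have "I \<noteq> J"
    using y by blast
  then show ?thesis
    unfolding field_op_eq[OF Q I x] field_op_eq[OF Q J] local_op_scale
      local_op_commute[OF I J(1) \<open>I \<noteq> J\<close>] by (simp add: mult.left_commute)
qed

text \<open>The interval containing \<open>z\<close> survives the halving of \<open>I\<close>, so
  its weight is the same on both sides.\<close>

lemma field_op_apply_halving:
  assumes Q: "Q \<in> dyadic_partitions" and I: "I \<in> Q" and z: "z \<in> {0..<1} - I"
  shows "field_op lam \<mu> \<alpha> (halve Q I) z (apply_halving V Q I \<psi>) =
    apply_halving V Q I (field_op lam \<mu> \<alpha> Q z \<psi>)"
proof -
  obtain J where J: "J \<in> Q" "z \<in> J"
    using z dyadic_partitionsD(2)[OF Q] by blast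
  then have "J \<noteq> I"
    using z by blast
  then have "J \<in> halve Q I"
    using J by (simp add: halve_def)
  show ?thesis
    unfolding field_op_eq[OF Q J] field_op_eq[OF halve_dyadic[OF Q I] \<open>J \<in> halve Q I\<close> J(2)]
      apply_halving_scale local_op_apply_halving[OF Q I J(1) \<open>J \<noteq> I\<close>] by (rule HOL.refl)
qed

text \<open>Halving the interval of \<open>z\<close> lowers the exponent of \<open>lam \<alpha>\<close> by one; this cancels the
  eigenvalue that \<^const>\<open>ascend\<close> produces.\<close>

lemma cinner_field_op_apply_halving:
  assumes Q: "Q \<in> dyadic_partitions" and I: "I \<in> Q" and z: "z \<in> I"
    and sym: "\<And>v. swap_factors (V *v v) = V *v v"
    and eigen: "ascend V (\<mu> \<alpha>) = cmat_scale (lam \<alpha>) (\<mu> \<alpha>)" and nz: "lam \<alpha> \<noteq> 0"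
  shows "cinner (halve Q I) (apply_halving V Q I \<phi>)
      (field_op lam \<mu> \<alpha> (halve Q I) z (apply_halving V Q I \<psi>)) =
    cinner Q \<phi> (field_op lam \<mu> \<alpha> Q z \<psi>)"
proof -
  note dI = dyadic_partitionsD(4)[OF Q I]
  obtain m where m: "\<lfloor>log 2 (measure lborel I)\<rfloor> = - int m"
    "\<lfloor>log 2 (measure lborel (left_half I))\<rfloor> = - int (Suc m)"
    "\<lfloor>log 2 (measure lborel (right_half I))\<rfloor> = - int (Suc m)"
    using log_measure_halves[OF dI] .
  have "lam \<alpha> powi (- int (Suc m)) * lam \<alpha> = lam \<alpha> powi (- int m)"
    using nz power_int_add_1[of "lam \<alpha>" "- int (Suc m)"] by simp
  then have exponent: "lam \<alpha> powi (- int (Suc m)) * (lam \<alpha> * c) = lam \<alpha> powi (- int m) * c" for c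
    by (metis mult.assoc)
  obtain K where K: "K \<in> halve Q I" "z \<in> K" "K = left_half I \<or> K = right_half I"
    using z halves_partition(1)[OF dI] by (auto simp: halve_def)
  \<comment> \<open>Read backwards, the eigenvalue is absorbed into the matrix, giving
    \<open>ascend V (\<mu> \<alpha>)\<close>. The swap symmetry makes the result the same for either
    half.\<close>
  have "cinner (halve Q I) (apply_halving V Q I \<phi>) (local_op (halve Q I) (\<mu> \<alpha>) K (apply_halving V Q I \<psi>)) =
      lam \<alpha> * cinner Q \<phi> (local_op Q (\<mu> \<alpha>) I \<psi>)"
    unfolding cinner_scale[symmetric] local_op_scale_mat[symmetric] eigen[symmetric]
    using K(3) cinner_local_op_left_half[OF Q I] cinner_local_op_right_half[OF Q I sym] by metis
  moreover have "\<lfloor>log 2 (measure lborel K)\<rfloor> = - int (Suc m)"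
    using K(3) m by auto
  ultimately show ?thesis
    unfolding field_op_eq[OF Q I z] field_op_eq[OF halve_dyadic[OF Q I] K(1,2)] m cinner_scale
    by (simp only: exponent)
qed

text \<open>Keeping types and points together as pairs allows induction on one list and splitting it
  at the point that lies in the halved interval.\<close>

definition field_ops ::
    "(nat \<Rightarrow> complex) \<Rightarrow> (nat \<Rightarrow> complex^'d^'d) \<Rightarrow> real set set \<Rightarrow> (nat \<times> real) list \<Rightarrow>
     'd state \<Rightarrow> ('d::finite) state" where
  "field_ops lam \<mu> Q zs = foldr (\<circ>) (map (\<lambda>(\<alpha>, x). field_op lam \<mu> \<alpha> Q x) zs) id"

lemma field_product_eq: "field_product lam \<mu> \<alpha>s xs Q = field_ops lam \<mu> Q (zip \<alpha>s xs)"
  by (simp add: field_product_def field_ops_def)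

lemma field_ops_simps [simp]:
  "field_ops lam \<mu> Q [] \<psi> = \<psi>"
  "field_ops lam \<mu> Q ((\<alpha>, x) # zs) \<psi> = field_op lam \<mu> \<alpha> Q x (field_ops lam \<mu> Q zs \<psi>)"
  by (simp_all add: field_ops_def)

lemma field_ops_append:
  "field_ops lam \<mu> Q (ys @ zs) \<psi> = field_ops lam \<mu> Q ys (field_ops lam \<mu> Q zs \<psi>)"
  by (induction ys) auto

lemma field_op_field_ops_commute:
  assumes "Q \<in> dyadic_partitions" "I \<in> Q" "x \<in> I" "snd ` set zs \<subseteq> {0..<1} - I"
  shows "field_op lam \<mu> \<alpha> Q x (field_ops lam \<mu> Q zs \<psi>) = field_ops lam \<mu> Q zs (field_op lam \<mu> \<alpha> Q x \<psi>)"
  using assms(4) by (induction zs) (auto simp: field_op_commute[OF assms(1-3)])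

lemma field_ops_apply_halving:
  assumes "Q \<in> dyadic_partitions" "I \<in> Q" "snd ` set zs \<subseteq> {0..<1} - I"
  shows "field_ops lam \<mu> (halve Q I) zs (apply_halving V Q I \<psi>) =
    apply_halving V Q I (field_ops lam \<mu> Q zs \<psi>)"
  using assms(3) by (induction zs) (auto simp: field_op_apply_halving[OF assms(1,2)])

text \<open>The at most one field operator in \<open>I\<close> is commuted to the front, past those that commute with
  the halving of \<open>I\<close>.\<close>

lemma cinner_field_ops_apply_halving:
  assumes V: "isometry V" and sym: "\<And>v. swap_factors (V *v v) = V *v v"
    and eigen: "\<And>\<alpha>. \<alpha> \<in> fst ` set zs \<Longrightarrow> ascend V (\<mu> \<alpha>) = cmat_scale (lam \<alpha>) (\<mu> \<alpha>) \<and> lam \<alpha> \<noteq> 0"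
    and zs: "snd ` set zs \<subseteq> {0..<1}" and supp: "supporting (map snd zs) Q" and I: "I \<in> Q"
  shows "cinner (halve Q I) (apply_halving V Q I \<phi>)
      (field_ops lam \<mu> (halve Q I) zs (apply_halving V Q I \<psi>)) =
    cinner Q \<phi> (field_ops lam \<mu> Q zs \<psi>)"
proof -
  have Q: "Q \<in> dyadic_partitions"
    using supp by (simp add: supporting_def)
  show ?thesis
  proof (cases "snd ` set zs \<subseteq> {0..<1} - I")
    case True
    then show ?thesis
      by (simp add: field_ops_apply_halving[OF Q I] cinner_apply_halving[OF Q I V])
  next
    case False
    then obtain \<alpha> x where x: "(\<alpha>, x) \<in> set zs" "x \<in> I"
      using zs by auto
    then obtain as bs where split: "zs = as @ (\<alpha>, x) # bs"
      by (meson split_list)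
    \<comment> \<open>\<open>supporting\<close> compares positions rather than values, so exactly
      the entry after \<open>as\<close> has its point in \<open>I\<close>.\<close>
    have unique: "i = length as" if "i < length zs" "snd (zs ! i) \<in> I" for i
    proof -
      have "map snd zs ! i \<in> I"
        using that by simp
      moreover have "map snd zs ! length as \<in> I"
        using x(2) by (simp add: split nth_append)
      moreover have "i < length (map snd zs)" "length as < length (map snd zs)"
        using that by (simp_all add: split)
      ultimately show ?thesis
        using supp I unfolding supporting_def by blast
    qed
    have "snd (as ! i) \<notin> I" if "i < length as" for i
      using unique[of i] that by (auto simp: split nth_append)
    then have "snd z \<notin> I" if "z \<in> set as" for z
      using that by (metis in_set_conv_nth)
    then have as: "snd ` set as \<subseteq> {0..<1} - I"
      using zs unfolding split set_append by blast
    have "snd (bs ! i) \<notin> I" if "i < length bs" for i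
      using unique[of "length as + Suc i"] that by (auto simp: split nth_append)
    then have "snd z \<notin> I" if "z \<in> set bs" for z
      using that by (metis in_set_conv_nth)
    then have bs: "snd ` set bs \<subseteq> {0..<1} - I"
      using zs unfolding split set_append list.set by blast
    let ?Q' = "halve Q I" and ?W = "apply_halving V Q I"
    \<comment> \<open>After the halving \<open>I\<close> is no longer an interval of the partition,
      so commutation there is argued with the half \<open>K\<close> around \<open>x\<close>.\<close>
    obtain K where K: "K \<in> ?Q'" "x \<in> K" "K \<subseteq> I"
      using x(2) halves_partition(1)[OF dyadic_partitionsD(4)[OF Q I]] by (auto simp: halve_def)
    have as': "snd ` set as \<subseteq> {0..<1} - K"
      using as K(3) by blast
    have "cinner ?Q' (?W \<phi>) (field_ops lam \<mu> ?Q' zs (?W \<psi>)) =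
        cinner ?Q' (?W \<phi>) (field_op lam \<mu> \<alpha> ?Q' x (field_ops lam \<mu> ?Q' (as @ bs) (?W \<psi>)))"
      by (simp add: split field_ops_append
          field_op_field_ops_commute[OF halve_dyadic[OF Q I] K(1,2) as'])
    also have "\<dots> = cinner ?Q' (?W \<phi>) (field_op lam \<mu> \<alpha> ?Q' x (?W (field_ops lam \<mu> Q (as @ bs) \<psi>)))"
      using as bs by (subst field_ops_apply_halving[OF Q I]) auto
    also have "\<dots> = cinner Q \<phi> (field_op lam \<mu> \<alpha> Q x (field_ops lam \<mu> Q (as @ bs) \<psi>))"
      using eigen[of \<alpha>] x by (intro cinner_field_op_apply_halving[OF Q I x(2) sym]) force+
    also have "\<dots> = cinner Q \<phi> (field_ops lam \<mu> Q zs \<psi>)"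
      by (simp add: split field_ops_append field_op_field_ops_commute[OF Q I x(2) as])
    finally show ?thesis .
  qed
qed

lemma supporting_refine:
  assumes "supporting xs P" "P \<preceq> Q"
  shows "supporting xs Q"
  using assms unfolding supporting_def coarser_iff by (meson subsetD)

text \<open>Every partition met along the halvings refines \<open>P\<close> and is therefore
  supporting, so the one-step relation can be iterated.\<close>

lemma cinner_field_ops_transition:
  assumes V: "isometry V" and sym: "\<And>v. swap_factors (V *v v) = V *v v"
    and eigen: "\<And>\<alpha>. \<alpha> \<in> fst ` set zs \<Longrightarrow> ascend V (\<mu> \<alpha>) = cmat_scale (lam \<alpha>) (\<mu> \<alpha>) \<and> lam \<alpha> \<noteq> 0"
    and zs: "snd ` set zs \<subseteq> {0..<1}" and supp: "supporting (map snd zs) P" and PQ: "P \<preceq> Q"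
  shows "cinner Q (transition V P Q \<phi>) (field_ops lam \<mu> Q zs (transition V P Q \<psi>)) =
    cinner P \<phi> (field_ops lam \<mu> P zs \<psi>)"
proof -
  have "cinner Q (T \<phi>) (field_ops lam \<mu> Q zs (T \<psi>)) = cinner P \<phi> (field_ops lam \<mu> P zs \<psi>)"
    if "halvings V P Q T" for T
    using that
  proof (induction rule: halvings.induct)
    case (step Q T I)
    have "supporting (map snd zs) Q"
      using supporting_refine[OF supp] halvings_coarser[OF step.hyps(1) coarserD(1)[OF PQ]] .
    from cinner_field_ops_apply_halving[OF V sym eigen zs this step.hyps(2)] step.IH
    show ?case
      by simp
  qed simp
  then show ?thesis
    using halvings_transition[OF PQ] by blast
qed

section \<open>The limit\<close>

text \<open>Directedness makes the tails a filter base, so an eventual property holds on a single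
  tail.\<close>

lemma eventually_refinement_filter:
  assumes "P \<in> dyadic_partitions"
  shows "eventually F (refinement_filter P) \<longleftrightarrow> (\<exists>R. P \<preceq> R \<and> (\<forall>Q. R \<preceq> Q \<longrightarrow> F Q))"
proof -
  have "\<exists>R\<in>{R. P \<preceq> R}. principal {Q. R \<preceq> Q} \<le> inf (principal {Q. A \<preceq> Q}) (principal {Q. B \<preceq> Q})"
    if AB: "A \<in> {R. P \<preceq> R}" "B \<in> {R. P \<preceq> R}" for A B
  proof -
    obtain R where R: "A \<preceq> R" "B \<preceq> R"
      using coarser_common_refinement AB coarserD(2) by (metis mem_Collect_eq)
    then show ?thesis
      using AB coarser_trans by (intro bexI[of _ R]) auto
  qed
  then show ?thesis
    using coarser_refl[OF assms] unfolding refinement_filter_def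
    by (subst eventually_INF_base) (auto simp: eventually_principal)
qed

text \<open>Each tail contains its own starting partition. Properness is what makes the limit unique
  and \<open>Lim\<close> meaningful.\<close>

lemma refinement_filter_neq_bot:
  assumes "P \<in> dyadic_partitions"
  shows "refinement_filter P \<noteq> bot"
  using eventually_refinement_filter[OF assms, of "\<lambda>_. False"] coarser_refl coarserD(2)
  by (metis eventually_bot)

text \<open>Convergence to \<open>correlation\<close>, which is defined by \<open>Lim\<close>,
  expresses existence of the limit. With at most one point the minimal supporting partition is
  \<open>{{0..<1}}\<close>, where the vacuum may have no representative and the description in
  \<open>vacuum_rep V P\<close> may have no solution; hence the condition on the value at
  \<open>P\<close>.\<close>

theorem theorem6p4:
  fixes V :: "complex^'d^('d::finite \<times> 'd)"
    and lam :: "nat \<Rightarrow> complex"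
    and \<mu> :: "nat \<Rightarrow> complex^'d^'d"
    and xs :: "real list"
    and \<alpha>s :: "nat list"
    and P :: "real set set"
  assumes "isometry V"
    and "\<And>v. swap_factors (V *v v) = V *v v"
    and "inj_on \<mu> {..<CARD('d)\<^sup>2}"
    and "cmat.independent (\<mu> ` {..<CARD('d)\<^sup>2})"
    and "cmat.span (\<mu> ` {..<CARD('d)\<^sup>2}) = UNIV"
    and "\<And>\<alpha>. \<alpha> < CARD('d)\<^sup>2 \<Longrightarrow> ascend V (\<mu> \<alpha>) = cmat_scale (lam \<alpha>) (\<mu> \<alpha>)"
    and "\<mu> 0 = mat 1" and "lam 0 = 1"
    and "\<And>\<alpha>. \<alpha> < CARD('d)\<^sup>2 \<Longrightarrow> lam \<alpha> \<noteq> 0"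
    and "set xs \<subseteq> {0..<1}" and "sorted_wrt (<) xs"
    and "length \<alpha>s = length xs" and "set \<alpha>s \<subseteq> {..<CARD('d)\<^sup>2}"
    and "minimal_supporting xs P"
  shows "(vacuum_expectation V lam \<mu> \<alpha>s xs \<longlongrightarrow> correlation V lam \<mu> \<alpha>s xs P)
           (refinement_filter P) \<and>
         (2 \<le> length xs \<or> has_vacuum_rep V P \<longrightarrow>
           correlation V lam \<mu> \<alpha>s xs P = vacuum_expectation V lam \<mu> \<alpha>s xs P)"
proof -
  let ?E = "vacuum_expectation V lam \<mu> \<alpha>s xs" and ?F = "refinement_filter P"
  have supp: "supporting xs P"
    using assms(14) by (simp add: minimal_supporting_def)
  then have P: "P \<in> dyadic_partitions"
    by (simp add: supporting_def)
  have snds: "map snd (zip \<alpha>s xs) = xs"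
    using assms(12) by simp
  have pos: "snd ` set (zip \<alpha>s xs) \<subseteq> {0..<1}"
    using assms(10) by (auto dest: set_zip_rightD)
  have eigen: "ascend V (\<mu> \<alpha>) = cmat_scale (lam \<alpha>) (\<mu> \<alpha>) \<and> lam \<alpha> \<noteq> 0"
    if "\<alpha> \<in> fst ` set (zip \<alpha>s xs)" for \<alpha>
    using that assms(6,9,13) by (auto dest!: set_zip_leftD)
  have const: "?E Q = ?E R" if "R \<preceq> Q" "supporting xs R" "has_vacuum_rep V R" for Q R
    unfolding vacuum_expectation_def field_product_eq vacuum_rep_refine(2)[OF that(1) assms(1) that(3)]
    using cinner_field_ops_transition[OF assms(1,2) eigen pos _ that(1)] that(2) snds by simp
  \<comment> \<open>The net is constant from any such \<open>R\<close> onwards; \<open>R\<close> is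
    later taken beyond \<open>halves\<close> for existence and equal to \<open>P\<close> for the
    value.\<close>
  have limit: "(?E \<longlongrightarrow> ?E R) ?F" "correlation V lam \<mu> \<alpha>s xs P = ?E R"
    if "P \<preceq> R" "has_vacuum_rep V R" for R
  proof -
    have "eventually (\<lambda>Q. ?E Q = ?E R) ?F"
      using eventually_refinement_filter[OF P] const supporting_refine[OF supp] that by blast
    then show "(?E \<longlongrightarrow> ?E R) ?F"
      by (rule tendsto_eventually)
    then show "correlation V lam \<mu> \<alpha>s xs P = ?E R"
      unfolding correlation_def by (intro tendsto_Lim refinement_filter_neq_bot[OF P])
  qed
  \<comment> \<open>Passing above \<open>halves\<close> secures a vacuum representative even when
    \<open>P\<close> has none.\<close>
  obtain R where "P \<preceq> R" "halves \<preceq> R"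
    using coarser_common_refinement[OF P halves_dyadic] .
  moreover have "has_vacuum_rep V R"
    using vacuum_rep_refine(1)[OF \<open>halves \<preceq> R\<close> assms(1) has_vacuum_rep_halves] .
  ultimately have "(?E \<longlongrightarrow> correlation V lam \<mu> \<alpha>s xs P) ?F"
    using limit by metis
  moreover have "has_vacuum_rep V P" if "2 \<le> length xs"
  proof -
    have "0 < length xs" "1 < length xs"
      using that by linarith+
    then have "xs ! 0 \<in> {0..<1}" "xs ! 1 \<in> {0..<1}"
      using assms(10) nth_mem by blast+
    \<comment> \<open>Otherwise the first two entries would share an interval of a supporting
      partition.\<close>
    then have "{0..<1} \<notin> P"
      using supp \<open>0 < length xs\<close> \<open>1 < length xs\<close> zero_neq_one unfolding supporting_def by blast
    then show ?thesis
      using vacuum_rep_refine(1)[OF halves_coarser[OF P] assms(1) has_vacuum_rep_halves] by blast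
  qed
  ultimately show ?thesis
    using limit(2)[OF coarser_refl[OF P]] by blast
qed

end
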